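(* Let $n\in\mathbb{N}$ ($n\ge 1$), let $a_k:\mathbb{R}^+\to\mathbb{C}$, $k=0,\dots,n$, be functions, let $1<p\leq q\leq\infty$, and let $u,v$ be two non-negative functions on $\mathbb{R}^+$. Assume that $$\int_0^r u^{-p'}(x)\,dx<\infty\quad\text{for all } r>0,$$ and that there exists a constant $D(u)$ such that $$\int_0^{2r}x^{(n-1)p'}u^{-p'}(x)\,dx\leq D(u)\int_0^r x^{(n-1)p'}u^{-p'}(x)\,dx\quad\text{for all } r>0.$$ Then the following three assertions are equivalent: (i) There is a constant $c<\infty$ such that for all $f\in L_{p,u}$ $$\bigg\|\sum_{k=0}^n a_k(x)\int_0^x t^k f(t)\,dt\,\Big|\,L_{q,v}\bigg\|\leq c\,\|f|L_{p,u}\|.$$ (ii) There are constants $c_0,\dots,c_n<\infty$ such that for all $f\in L_{p,u}$ $$\bigg\|a_k(x)\int_0^x t^k f(t)\,dt\,\Big|\,L_{q,v}\bigg\|\leq c_k\,\|f|L_{p,u}\|,\qquad k=0,\dots,n.$$ (iii) The values $$S_k=\sup_{r>0}\bigg(\int_r^\infty |a_k(x)v(x)|^q\,dx\bigg)^{1/q}\bigg(\int_0^r x^{kp'}u^{-p'}(x)\,dx\bigg)^{1/p'},\qquad k=0,\dots,n,$$ are all finite. Moreover, if $\widetilde{c}$ is the best constant in (i), then $$K_1\,\widetilde{c}\leq\sum_{k=0}^n S_k\leq K_2\,\widetilde{c},$$ where $K_1=K_1(p,q)>0$ is a constant depending only on $p,q$, and $K_2=K_2(D(u),n,p,q)<\infty$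 is a constant depending only on $D(u),n,p,q$.
   Context: $\mathbb{R}^+=(0,\infty)$. All functions are assumed to be (Lebesgue) measurable and finite almost everywhere. $p'=p/(p-1)$ denotes the conjugate exponent ($p'=1$ if $p=\infty$). For a non-negative function $u$ on $\mathbb{R}^+$ (a weight), $L_{p,u}$ is the space of functions $f:\mathbb{R}^+\to\mathbb{C}$ with finite norm $\|f|L_{p,u}\|=\big(\int_0^\infty|u(x)f(x)|^p\,dx\big)^{1/p}$ for $1\le p<\infty$, and $\|f|L_{\infty,u}\|=\operatorname{ess\,sup}_{x>0}|u(x)f(x)|$. Whenever an exponent equals $\infty$, expressions of the form $(\int|\cdot|^q)^{1/q}$ are understood as the essential supremum over the corresponding set. $u^{-p'}(x)$ means $(u(x))^{-p'}$, equal to $+\infty$ where $u(x)=0$. *)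

theory Defs
  imports "HOL-Analysis.Analysis" "HOL-Probability.Essential_Supremum"
begin

text \<open>Exponents range over \<open>ennreal\<close>, the value \<open>\<infinity>\<close> included. Weights also take values in
  \<open>ennreal\<close>, so that the value \<open>\<infinity>\<close> is possible on a null set. Functions have type
  \<open>real \<Rightarrow> _\<close>; only their restriction to \<open>{0<..}\<close> is ever used.\<close>

text \<open>Only used with a positive exponent \<open>s\<close>; there \<open>0\<close> is mapped to \<open>0\<close> and \<open>\<infinity>\<close> to \<open>\<infinity>\<close>.\<close>

definition ennpowr :: "ennreal \<Rightarrow> real \<Rightarrow> ennreal" where
  "ennpowr y s = (if y = \<infinity> then \<infinity> else ennreal (enn2real y powr s))"

text \<open>Meaningful for \<open>1 < p\<close>, where the result is a real number in \<open>[1, \<infinity>)\<close>.\<close>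

definition conj_exp :: "ennreal \<Rightarrow> real" where
  "conj_exp p = (if p = \<infinity> then 1 else enn2real p / (enn2real p - 1))"

definition lp_norm :: "ennreal \<Rightarrow> real set \<Rightarrow> (real \<Rightarrow> ennreal) \<Rightarrow> ennreal" where
  "lp_norm p A g =
     (if p = \<infinity> then esssup (lebesgue_on A) g
      else ennpowr (\<integral>\<^sup>+x. ennpowr (g x) (enn2real p) \<partial>lebesgue_on A) (1 / enn2real p))"

definition weighted_norm :: "ennreal \<Rightarrow> (real \<Rightarrow> ennreal) \<Rightarrow> (real \<Rightarrow> complex) \<Rightarrow> ennreal" where
  "weighted_norm p u f = lp_norm p {0<..} (\<lambda>x. u x * ennreal (cmod (f x)))"

definition weighted_space :: "ennreal \<Rightarrow> (real \<Rightarrow> ennreal) \<Rightarrow> (real \<Rightarrow> complex) set" where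
  "weighted_space p u =
     {f. f \<in> borel_measurable (lebesgue_on {0<..}) \<and> weighted_norm p u f < \<infinity>}"

definition weight :: "(real \<Rightarrow> ennreal) \<Rightarrow> bool" where
  "weight u \<longleftrightarrow> u \<in> borel_measurable (lebesgue_on {0<..}) \<and> (AE x in lebesgue_on {0<..}. u x < \<infinity>)"

text \<open>The integral of \<open>x\<^bsup>s p'\<^esup> u\<^bsup>-p'\<^esup>(x)\<close> over \<open>(0, r)\<close>. As \<open>inverse 0 = \<infinity>\<close> in \<open>ennreal\<close>,
  the factor \<open>u\<^bsup>-p'\<^esup>(x)\<close> is \<open>\<infinity>\<close> where \<open>u\<close> vanishes.\<close>

definition dual_integral :: "ennreal \<Rightarrow> (real \<Rightarrow> ennreal) \<Rightarrow> real \<Rightarrow> real \<Rightarrow> ennreal" where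
  "dual_integral p u s r =
     (\<integral>\<^sup>+x. ennreal (x powr (s * conj_exp p)) * ennpowr (inverse (u x)) (conj_exp p)
        \<partial>lebesgue_on {0<..<r})"

text \<open>If \<open>dual_integral p u 0 x\<close> is finite, Hoelder's inequality makes the integrand Lebesgue
  integrable for every \<open>f \<in> weighted_space p u\<close>.\<close>

definition hardy :: "nat \<Rightarrow> (real \<Rightarrow> complex) \<Rightarrow> real \<Rightarrow> complex" where
  "hardy k f x = (LINT t|lebesgue_on {0<..<x}. complex_of_real t ^ k * f t)"

definition sum_bounded_by ::
  "nat \<Rightarrow> (nat \<Rightarrow> real \<Rightarrow> complex) \<Rightarrow> ennreal \<Rightarrow> ennreal \<Rightarrow>
   (real \<Rightarrow> ennreal) \<Rightarrow> (real \<Rightarrow> ennreal) \<Rightarrow> ennreal \<Rightarrow> bool" where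
  "sum_bounded_by n a p q u v c \<longleftrightarrow>
     (\<forall>f\<in>weighted_space p u.
        weighted_norm q v (\<lambda>x. \<Sum>k\<le>n. a k x * hardy k f x) \<le> c * weighted_norm p u f)"

text \<open>Equals \<open>\<infinity>\<close> (the infimum of the empty set) if there is no finite constant.\<close>

definition best_constant ::
  "nat \<Rightarrow> (nat \<Rightarrow> real \<Rightarrow> complex) \<Rightarrow> ennreal \<Rightarrow> ennreal \<Rightarrow>
   (real \<Rightarrow> ennreal) \<Rightarrow> (real \<Rightarrow> ennreal) \<Rightarrow> ennreal" where
  "best_constant n a p q u v = Inf {c. c < \<infinity> \<and> sum_bounded_by n a p q u v c}"

definition S_value ::
  "(nat \<Rightarrow> real \<Rightarrow> complex) \<Rightarrow> ennreal \<Rightarrow> ennreal \<Rightarrow>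
   (real \<Rightarrow> ennreal) \<Rightarrow> (real \<Rightarrow> ennreal) \<Rightarrow> nat \<Rightarrow> ennreal" where
  "S_value a p q u v k =
     (SUP r\<in>{0<..}. lp_norm q {r<..} (\<lambda>x. ennreal (cmod (a k x)) * v x) *
        ennpowr (dual_integral p u (real k) r) (1 / conj_exp p))"

end

theory Submission
  imports Defs "Jordan_Normal_Form.Determinant"
begin

text \<open>
Write \<open>w = u\<^bsup>-p'\<^esup>\<close> and \<open>W\<^sub>k(r)\<close> for the integral of \<open>x\<^bsup>k p'\<^esup> w\<close> over \<open>(0, r)\<close>. The theorem combines
an upper bound, valid for each summand separately, with a duality argument that isolates a single
summand in the sum.

\<^emph>\<open>From (iii) to (ii) and (i).\<close> The \<open>k\<close>-th summand is dominated by \<open>|a\<^sub>k|\<close> times the primitive of \<open>t\<^sup>k |f|\<close>,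
and finiteness of \<open>S\<^sub>k\<close> is the Muckenhoupt--Bradley condition for the two-weight Hardy inequality
(\<open>weighted_hardy_inequality\<close>). Cutting the half line at the points where the primitive takes the
values \<open>2\<^sup>i\<close> proves it with constant \<open>4\<close>, whatever \<open>p \<le> q\<close>. Minkowski's inequality
(\<open>sum_bounded_by_components\<close>) then leads to (i) with the constant \<open>4 * \<Sum>k\<le>n. S\<^sub>k\<close>, whence \<open>K1 = 1/4\<close>.

\<^emph>\<open>From (i) to (iii).\<close> Fix \<open>r\<close> and \<open>j\<close>. If \<open>f\<close> vanishes beyond \<open>r\<close> and its moments of order
\<open>0, \<dots>, n\<close> are all \<open>0\<close> except the \<open>j\<close>-th, which is \<open>1\<close>, then the sum equals \<open>a\<^sub>j(x)\<close> for \<open>x > r\<close>, and (i) bounds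
the norm of \<open>a\<^sub>j v\<close> on \<open>(r, \<infinity>)\<close> by \<open>c\<close> times the norm of \<open>f\<close>. Hence everything depends on finding such an \<open>f\<close>
whose norm is at most a constant times \<open>W\<^sub>j(r) powr (- 1 / p')\<close>, the value that Hoelder's
inequality allows for the \<open>j\<close>-th moment alone (\<open>test_function\<close>).

Such an \<open>f\<close> is a combination of \<open>n + 1\<close> bumps, each extremal for Hoelder's inequality on its own interval
(\<open>bump\<close>). Testing a polynomial against a bump amounts, by the mean value theorem, to evaluating it at
some point of the interval up to a power of that point. So the coefficients of the combination are
coefficients of Lagrange polynomials with unknown nodes in the intervals, and they are bounded as
soon as the intervals are separated by a factor \<open>2\<close> (\<open>moment_dual_basis\<close>). The intervals
are found by repeatedly halving the mass: there is no need for them to be comparable in length, and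
the doubling condition is used only to skip a factor \<open>2\<close> between consecutive intervals at bounded
cost (\<open>halving_points\<close>).
\<close>

(* Throughout, top is the greatest element of ennreal, not the one of an abstract order. *)
hide_const (open) Order.top

section \<open>Powers of extended nonnegative reals\<close>

lemma ennpowr_ennreal: "0 \<le> x \<Longrightarrow> ennpowr (ennreal x) s = ennreal (x powr s)"
  by (simp add: ennpowr_def)

lemma ennpowr_top [simp]: "ennpowr top s = top"
  by (simp add: ennpowr_def)

lemma ennpowr_0 [simp]: "ennpowr 0 s = 0"
  by (simp add: ennpowr_def)

lemma ennpowr_one [simp]: "ennpowr y 1 = y"
  by (cases y) (auto simp: ennpowr_ennreal)

lemma ennpowr_eq_0_iff [simp]: "ennpowr y s = 0 \<longleftrightarrow> y = 0"
  by (cases y) (auto simp: ennpowr_ennreal ennreal_eq_0_iff)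

lemma ennpowr_eq_top_iff [simp]: "ennpowr y s = top \<longleftrightarrow> y = top"
  by (cases y) (auto simp: ennpowr_ennreal)

lemma ennpowr_less_top_iff [simp]: "ennpowr y s < top \<longleftrightarrow> y < top"
  by (simp add: less_top[symmetric])

lemma ennpowr_mono: "0 \<le> s \<Longrightarrow> y \<le> z \<Longrightarrow> ennpowr y s \<le> ennpowr z s"
  by (cases y; cases z)
    (auto simp: ennpowr_ennreal ennreal_leI powr_mono2 top_unique)

lemma ennpowr_mult: "ennpowr (y * z) s = ennpowr y s * ennpowr z s"
proof (cases "y = top \<or> z = top")
  case True
  then show ?thesis
    by (auto simp: ennreal_mult_top ennreal_top_mult)
next
  case False
  then show ?thesis
    by (cases y; cases z)
      (auto simp: ennpowr_ennreal powr_mult ennreal_mult[symmetric])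
qed

lemma ennpowr_ennpowr: "ennpowr (ennpowr y s) t = ennpowr y (s * t)"
  by (cases y) (auto simp: ennpowr_ennreal powr_powr)

lemma ennpowr_add: "ennpowr y (s + t) = ennpowr y s * ennpowr y t"
  by (cases y) (auto simp: ennpowr_ennreal powr_add ennreal_mult[symmetric] ennreal_top_mult)

lemma ennpowr_cancel: "s \<noteq> 0 \<Longrightarrow> ennpowr (ennpowr y s) (1 / s) = y"
  by (simp add: ennpowr_ennpowr)

lemma ennpowr_cancel': "s \<noteq> 0 \<Longrightarrow> ennpowr (ennpowr y (1 / s)) s = y"
  by (simp add: ennpowr_ennpowr)

lemma ennpowr_measurable [measurable]: "(\<lambda>y. ennpowr y s) \<in> borel_measurable borel"
  unfolding ennpowr_def by measurable

lemma ennpowr_measurable_comp [measurable (raw)]: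
  "f \<in> borel_measurable M \<Longrightarrow> (\<lambda>x. ennpowr (f x) s) \<in> borel_measurable M"
  using measurable_compose[OF _ ennpowr_measurable] .

lemma ennpowr_le_iff: "0 < s \<Longrightarrow> ennpowr y s \<le> ennpowr z s \<longleftrightarrow> y \<le> z"
  by (metis ennpowr_cancel ennpowr_mono less_eq_real_def less_numeral_extra(3) zero_le_divide_1_iff)

text \<open>Convexity of \<open>x powr s\<close> on the open half line extends to the two end points: where one argument
vanishes it says \<open>c powr s \<le> c\<close> for \<open>0 < c \<le> 1\<close>, and where one is infinite both sides are.\<close>

lemma ennpowr_convex:
  assumes "1 \<le> s" "0 < lam" "0 < kap" "lam + kap = (1::real)"
  shows "ennpowr (ennreal lam * y + ennreal kap * z) s
     \<le> ennreal lam * ennpowr y s + ennreal kap * ennpowr z s"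
proof (cases "y = top \<or> z = top")
  case True
  then show ?thesis using assms
    by (auto simp: ennreal_mult_top ennreal_top_mult)
next
  case False
  then obtain a b where ab: "y = ennreal a" "z = ennreal b" "0 \<le> a" "0 \<le> b"
    by (cases y; cases z) auto
  have lam: "lam = 1 - kap" and "lam \<le> 1" "kap \<le> 1"
    using assms by auto
  have aux: "c powr s * d \<le> c powr 1 * d" if "0 \<le> c" "c \<le> 1" "0 \<le> d" for c d :: real
  proof (rule mult_right_mono)
    show "c powr s \<le> c powr 1"
      using that assms(1) by (intro powr_mono') auto
  qed (use that in auto)
  have "(lam * a + kap * b) powr s \<le> lam * a powr s + kap * b powr s"
  proof (cases "a = 0 \<or> b = 0")
    case True
    then show ?thesis
    proof
      assume "a = 0"
      with aux[of kap "b powr s"] assms(1-3) ab \<open>kap \<le> 1\<close> show ?thesis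
        by (simp add: powr_mult)
    next
      assume "b = 0"
      with aux[of lam "a powr s"] assms(1-3) ab \<open>lam \<le> 1\<close> show ?thesis
        by (simp add: powr_mult)
    qed
  next
    case False
    then show ?thesis
      using convex_onD[OF powr_convex[OF assms(1)], of kap a b] ab assms(2,3) lam
      by simp
  qed
  then show ?thesis using ab assms
    by (simp add: ennpowr_ennreal ennreal_mult[symmetric] ennreal_plus[symmetric] del: ennreal_plus)
qed

lemma ennreal_Youngs_inequality:
  assumes "1 < s" "1 < t" "1 / s + 1 / t = (1::real)"
  shows "y * z \<le> ennreal (1/s) * ennpowr y s + ennreal (1/t) * ennpowr z t"
proof (cases "y = top \<or> z = top")
  case True
  then show ?thesis using assms
    by (auto simp: ennreal_mult_top ennreal_top_mult)
next
  case False
  then obtain a b where ab: "y = ennreal a" "z = ennreal b" "0 \<le> a" "0 \<le> b"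
    by (cases y; cases z) auto
  then show ?thesis
    using Youngs_inequality[OF assms, of a b] assms
    by (simp add: ennpowr_ennreal ennreal_mult[symmetric] ennreal_plus[symmetric] ennreal_leI del: ennreal_plus)
qed

section \<open>Hoelder and Minkowski inequalities\<close>

lemma enn2real_gt_1: "1 < p \<Longrightarrow> p \<noteq> \<infinity> \<Longrightarrow> 1 < enn2real p"
  by (cases p) (auto simp: one_less_ennreal)

lemma conj_exp_ge_1: "1 < p \<Longrightarrow> 1 \<le> conj_exp p"
  using enn2real_gt_1[of p] by (auto simp: conj_exp_def field_simps)

lemma conj_exp_pos: "1 < p \<Longrightarrow> 0 < conj_exp p"
  using conj_exp_ge_1[of p] by simp

lemma conj_exp_conjugate:
  assumes "1 < p" "p \<noteq> \<infinity>"
  shows "1 < conj_exp p" "1 / enn2real p + 1 / conj_exp p = 1"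
    "(conj_exp p - 1) * enn2real p = conj_exp p"
  using enn2real_gt_1[OF assms] assms(2) by (auto simp: conj_exp_def divide_simps)

lemma lp_norm_infinity: "lp_norm top A f = esssup (lebesgue_on A) f"
  by (simp add: lp_norm_def)

lemma lp_norm_finite:
  "p \<noteq> \<infinity> \<Longrightarrow> lp_norm p A f =
     ennpowr (\<integral>\<^sup>+x. ennpowr (f x) (enn2real p) \<partial>lebesgue_on A) (1 / enn2real p)"
  by (simp add: lp_norm_def)

lemma ennpowr_lp_norm:
  "1 < p \<Longrightarrow> p \<noteq> \<infinity> \<Longrightarrow> ennpowr (lp_norm p A f) (enn2real p) =
     (\<integral>\<^sup>+x. ennpowr (f x) (enn2real p) \<partial>lebesgue_on A)"
  using enn2real_gt_1[of p] by (simp add: lp_norm_finite ennpowr_cancel')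

lemma lp_norm_mono_AE:
  assumes "1 < p" "f \<in> borel_measurable (lebesgue_on A)" "AE x in lebesgue_on A. f x \<le> g x"
  shows "lp_norm p A f \<le> lp_norm p A g"
proof (cases "p = \<infinity>")
  case True
  then show ?thesis using assms by (simp add: lp_norm_def esssup_AE_mono)
next
  case False
  have "AE x in lebesgue_on A. ennpowr (f x) (enn2real p) \<le> ennpowr (g x) (enn2real p)"
    using assms(3) by eventually_elim (simp add: ennpowr_mono)
  then show ?thesis using False
    by (auto simp: lp_norm_finite intro!: ennpowr_mono nn_integral_mono_AE)
qed

lemma lp_norm_subset:
  assumes "1 < p" "A \<subseteq> B" "A \<in> sets lebesgue" "B \<in> sets lebesgue"
  shows "lp_norm p A f \<le> lp_norm p B f"
proof (cases "p = \<infinity>")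
  case True
  show ?thesis
  proof (cases "f \<in> borel_measurable (lebesgue_on B)")
    case m: True
    have "AE x in lebesgue_on B. f x \<le> esssup (lebesgue_on B) f"
      by (rule esssup_AE)
    then have "AE x in lebesgue_on A. f x \<le> esssup (lebesgue_on B) f"
      using assms by (auto simp: AE_restrict_space_iff elim!: eventually_mono)
    moreover have "f \<in> borel_measurable (lebesgue_on A)"
      using measurable_restrict_mono[OF m assms(2)] .
    ultimately show ?thesis
      by (auto simp: True lp_norm_infinity)
  qed (simp add: True lp_norm_infinity esssup_non_measurable)
next
  case False
  have "(\<integral>\<^sup>+x. ennpowr (f x) (enn2real p) \<partial>lebesgue_on A)
      \<le> (\<integral>\<^sup>+x. ennpowr (f x) (enn2real p) \<partial>lebesgue_on B)"
    using assms by (auto simp: nn_integral_restrict_space intro!: nn_integral_mono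
      split: split_indicator)
  then show ?thesis using False by (simp add: lp_norm_finite ennpowr_mono)
qed

lemma lp_norm_cmult_le:
  assumes "1 < p" "f \<in> borel_measurable (lebesgue_on A)"
  shows "lp_norm p A (\<lambda>x. c * f x) \<le> c * lp_norm p A f"
proof (cases "p = \<infinity>")
  case True
  have "AE x in lebesgue_on A. c * f x \<le> c * esssup (lebesgue_on A) f"
    using esssup_AE[of f "lebesgue_on A"] by eventually_elim (simp add: mult_left_mono)
  with assms show ?thesis
    by (auto simp: True lp_norm_infinity)
next
  case False
  then show ?thesis using assms enn2real_gt_1[OF assms(1)]
    by (simp add: lp_norm_finite ennpowr_mult nn_integral_cmult ennpowr_cancel)
qed

lemma lp_norm_eq_0:
  assumes "1 < p" "f \<in> borel_measurable (lebesgue_on A)" "lp_norm p A f = 0"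
  shows "AE x in lebesgue_on A. f x = 0"
proof (cases "p = \<infinity>")
  case True
  then show ?thesis using esssup_AE[of f "lebesgue_on A"] assms(3)
    by (simp add: lp_norm_infinity)
next
  case False
  then show ?thesis using assms by (simp add: lp_norm_finite nn_integral_0_iff_AE)
qed

text \<open>Minkowski's inequality. With \<open>a\<close>, \<open>b\<close> the norms of \<open>f\<close>, \<open>g\<close>, the sum is \<open>a + b\<close> times a convex
combination, with weights \<open>a / (a + b)\<close> and \<open>b / (a + b)\<close>, of the normalised functions, so that
convexity of the power bounds the integral by \<open>(a + b) powr p\<close>.\<close>

lemma lp_norm_triangle:
  assumes p: "1 < p" and [measurable]: "f \<in> borel_measurable (lebesgue_on A)"
    "g \<in> borel_measurable (lebesgue_on A)"
  shows "lp_norm p A (\<lambda>x. f x + g x) \<le> lp_norm p A f + lp_norm p A g"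
proof (cases "p = \<infinity>")
  case True
  have "AE x in lebesgue_on A. f x + g x \<le> esssup (lebesgue_on A) f + esssup (lebesgue_on A) g"
    using esssup_AE[of f "lebesgue_on A"] esssup_AE[of g "lebesgue_on A"]
    by eventually_elim (rule add_mono)
  then show ?thesis by (auto simp: True lp_norm_infinity)
next
  case False
  define s where "s = enn2real p"
  have s: "1 < s" using enn2real_gt_1[OF p False] by (simp add: s_def)
  consider "lp_norm p A f = 0" | "lp_norm p A g = 0" | "lp_norm p A f = top \<or> lp_norm p A g = top"
    | "lp_norm p A f \<noteq> 0" "lp_norm p A g \<noteq> 0" "lp_norm p A f \<noteq> top" "lp_norm p A g \<noteq> top"
    by blast
  then show ?thesis
  proof cases
    case 1
    then have "AE x in lebesgue_on A. f x = 0" using p by (simp add: lp_norm_eq_0)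
    then have "AE x in lebesgue_on A. f x + g x \<le> g x" by eventually_elim simp
    then show ?thesis using p 1 by (auto intro!: lp_norm_mono_AE)
  next
    case 2
    then have "AE x in lebesgue_on A. g x = 0" using p by (simp add: lp_norm_eq_0)
    then have "AE x in lebesgue_on A. f x + g x \<le> f x" by eventually_elim simp
    then show ?thesis using p 2 by (auto intro!: lp_norm_mono_AE)
  next
    case 3
    then show ?thesis by auto
  next
    case 4
    obtain a where a: "lp_norm p A f = ennreal a" "a > 0"
      using 4 by (cases "lp_norm p A f") (auto simp: ennreal_eq_0_iff)
    obtain b where b: "lp_norm p A g = ennreal b" "b > 0"
      using 4 by (cases "lp_norm p A g") (auto simp: ennreal_eq_0_iff)
    define lam kap where "lam = a / (a + b)" and "kap = b / (a + b)"
    have lk: "0 < lam" "0 < kap" "lam + kap = 1"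
      using a b by (auto simp: lam_def kap_def add_divide_distrib[symmetric])
    have F: "(\<integral>\<^sup>+x. ennpowr (f x) s \<partial>lebesgue_on A) = ennreal (a powr s)"
      using ennpowr_lp_norm[OF p False, of A f] a by (simp add: s_def ennpowr_ennreal)
    have G: "(\<integral>\<^sup>+x. ennpowr (g x) s \<partial>lebesgue_on A) = ennreal (b powr s)"
      using ennpowr_lp_norm[OF p False, of A g] b by (simp add: s_def ennpowr_ennreal)
    have eq: "f x + g x = ennreal (a + b) *
        (ennreal lam * (ennreal (1/a) * f x) + ennreal kap * (ennreal (1/b) * g x))" for x
    proof -
      have "(a + b) * (lam * (1 / a)) = 1" "(a + b) * (kap * (1 / b)) = 1"
        using a b by (auto simp: lam_def kap_def)
      then have "ennreal (a + b) * (ennreal lam * ennreal (1 / a)) = 1"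
        "ennreal (a + b) * (ennreal kap * ennreal (1 / b)) = 1"
        using a b lk by (auto simp: ennreal_mult[symmetric] simp del: ennreal_plus)
      then show ?thesis
        unfolding distrib_left mult.assoc[symmetric] by simp
    qed
    have bd: "ennpowr (f x + g x) s \<le> ennreal ((a + b) powr s) *
       (ennreal lam * (ennreal ((1/a) powr s) * ennpowr (f x) s)
          + ennreal kap * (ennreal ((1/b) powr s) * ennpowr (g x) s))" for x
    proof -
      have "ennpowr (f x + g x) s = ennpowr (ennreal (a + b)) s *
        ennpowr (ennreal lam * (ennreal (1/a) * f x) + ennreal kap * (ennreal (1/b) * g x)) s"
        by (subst eq) (rule ennpowr_mult)
      also have "\<dots> \<le> ennpowr (ennreal (a + b)) s * (ennreal lam * ennpowr (ennreal (1/a) * f x) s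
          + ennreal kap * ennpowr (ennreal (1/b) * g x) s)"
        using lk s by (intro mult_left_mono ennpowr_convex) auto
      finally show ?thesis using a b
        by (simp add: ennpowr_mult ennpowr_ennreal del: ennreal_plus)
    qed
    have one: "ennreal ((1/c) powr s) * ennreal (c powr s) = 1" if "c > 0" for c
      using that by (simp add: ennreal_mult[symmetric] powr_mult[symmetric])
    have "(\<integral>\<^sup>+x. ennpowr (f x + g x) s \<partial>lebesgue_on A) \<le>
      (\<integral>\<^sup>+x. ennreal ((a + b) powr s) *
       (ennreal lam * (ennreal ((1/a) powr s) * ennpowr (f x) s)
          + ennreal kap * (ennreal ((1/b) powr s) * ennpowr (g x) s)) \<partial>lebesgue_on A)"
      by (rule nn_integral_mono) (rule bd)
    also have "\<dots> = ennreal ((a + b) powr s) *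
       (ennreal lam * (ennreal ((1/a) powr s) * ennreal (a powr s))
          + ennreal kap * (ennreal ((1/b) powr s) * ennreal (b powr s)))"
      by (simp add: nn_integral_cmult nn_integral_add F G del: ennreal_plus)
    also have "\<dots> = ennpowr (ennreal (a + b)) s"
      using a b lk by (simp add: one ennpowr_ennreal ennreal_plus[symmetric] del: ennreal_plus)
    finally have "lp_norm p A (\<lambda>x. f x + g x) \<le> ennpowr (ennpowr (ennreal (a + b)) s) (1 / s)"
      using False s by (simp add: lp_norm_finite s_def ennpowr_mono)
    also have "\<dots> = lp_norm p A f + lp_norm p A g"
      using s a b by (simp add: ennpowr_cancel)
    finally show ?thesis .
  qed
qed

lemma lp_norm_sum_le:
  assumes "1 < p" "finite I" "\<And>i. i \<in> I \<Longrightarrow> f i \<in> borel_measurable (lebesgue_on A)"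
  shows "lp_norm p A (\<lambda>x. \<Sum>i\<in>I. f i x) \<le> (\<Sum>i\<in>I. lp_norm p A (f i))"
  using assms(2,3)
proof (induction I rule: finite_induct)
  case empty
  show ?case
  proof (cases "p = \<infinity>")
    case True
    then show ?thesis using esssup_I[of "\<lambda>_. 0::ennreal" "lebesgue_on A" 0]
      by (simp add: lp_norm_infinity)
  qed (simp add: lp_norm_finite)
next
  case (insert i I)
  have "lp_norm p A (\<lambda>x. f i x + (\<Sum>i\<in>I. f i x)) \<le> lp_norm p A (f i) + lp_norm p A (\<lambda>x. \<Sum>i\<in>I. f i x)"
    using assms insert by (intro lp_norm_triangle) auto
  also have "\<dots> \<le> lp_norm p A (f i) + (\<Sum>i\<in>I. lp_norm p A (f i))"
    using insert by (intro add_left_mono) auto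
  finally show ?case using insert by simp
qed

text \<open>Hoelder's inequality: Young's inequality applied to the normalised functions, with the exponent
\<open>p = \<infinity>\<close> (where \<open>conj_exp p = 1\<close>) included.\<close>

lemma lp_norm_Hoelder:
  assumes p: "1 < p" and [measurable]: "f \<in> borel_measurable (lebesgue_on A)"
    "g \<in> borel_measurable (lebesgue_on A)"
  shows "(\<integral>\<^sup>+x. f x * g x \<partial>lebesgue_on A) \<le>
    lp_norm p A f * ennpowr (\<integral>\<^sup>+x. ennpowr (g x) (conj_exp p) \<partial>lebesgue_on A) (1 / conj_exp p)"
proof (cases "p = \<infinity>")
  case True
  have "AE x in lebesgue_on A. f x * g x \<le> lp_norm p A f * g x"
    using esssup_AE[of f "lebesgue_on A"]
    by eventually_elim (simp add: True lp_norm_infinity mult_right_mono)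
  then have "(\<integral>\<^sup>+x. f x * g x \<partial>lebesgue_on A) \<le> (\<integral>\<^sup>+x. lp_norm p A f * g x \<partial>lebesgue_on A)"
    by (rule nn_integral_mono_AE)
  then show ?thesis by (simp add: True conj_exp_def nn_integral_cmult)
next
  case False
  define s t where "s = enn2real p" and "t = conj_exp p"
  define M where "M = ennpowr (\<integral>\<^sup>+x. ennpowr (g x) t \<partial>lebesgue_on A) (1 / t)"
  have st: "1 < s" "1 < t" "1 / s + 1 / t = 1"
    using enn2real_gt_1[OF p False] conj_exp_conjugate[OF p False] by (auto simp: s_def t_def)
  consider "lp_norm p A f = 0" | "M = 0" | "lp_norm p A f \<noteq> 0" "M \<noteq> 0" "lp_norm p A f = top \<or> M = top"
    | "lp_norm p A f \<noteq> 0" "M \<noteq> 0" "lp_norm p A f \<noteq> top" "M \<noteq> top"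
    by blast
  then have "(\<integral>\<^sup>+x. f x * g x \<partial>lebesgue_on A) \<le> lp_norm p A f * M"
  proof cases
    case 1
    then have "AE x in lebesgue_on A. f x = 0" using p by (simp add: lp_norm_eq_0)
    then have "AE x in lebesgue_on A. f x * g x = 0" by eventually_elim simp
    then show ?thesis by (simp add: nn_integral_0_iff_AE[THEN iffD2])
  next
    case 2
    then have "AE x in lebesgue_on A. g x = 0" by (simp add: M_def nn_integral_0_iff_AE)
    then have "AE x in lebesgue_on A. f x * g x = 0" by eventually_elim simp
    then show ?thesis by (simp add: nn_integral_0_iff_AE[THEN iffD2])
  next
    case 3
    then have "lp_norm p A f * M = top" by (auto simp: ennreal_mult_eq_top_iff)
    then show ?thesis by simp
  next
    case 4
    obtain a where a: "lp_norm p A f = ennreal a" "a > 0"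
      using 4 by (cases "lp_norm p A f") (auto simp: ennreal_eq_0_iff)
    obtain b where b: "M = ennreal b" "b > 0"
      using 4 by (cases M) (auto simp: ennreal_eq_0_iff)
    have F: "(\<integral>\<^sup>+x. ennpowr (f x) s \<partial>lebesgue_on A) = ennreal (a powr s)"
      using ennpowr_lp_norm[OF p False, of A f] a by (simp add: s_def ennpowr_ennreal)
    have "ennpowr M t = (\<integral>\<^sup>+x. ennpowr (g x) t \<partial>lebesgue_on A)"
      using st by (simp add: M_def ennpowr_cancel')
    then have G: "(\<integral>\<^sup>+x. ennpowr (g x) t \<partial>lebesgue_on A) = ennreal (b powr t)"
      using b by (simp add: ennpowr_ennreal)
    have bd: "f x * g x \<le> ennreal (a * b) * (ennreal (1/s) * (ennreal ((1/a) powr s) * ennpowr (f x) s)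
        + ennreal (1/t) * (ennreal ((1/b) powr t) * ennpowr (g x) t))" for x
    proof -
      have "(a * b) * ((1/a) * (1/b)) = 1" using a b by simp
      then have "ennreal (a * b) * (ennreal (1/a) * ennreal (1/b)) = 1"
        using a b by (simp add: ennreal_mult[symmetric] del: times_divide_eq_left times_divide_eq_right)
      then have "f x * g x = ennreal (a * b) * (ennreal (1/a) * ennreal (1/b)) * (f x * g x)"
        by simp
      also have "\<dots> = ennreal (a * b) * ((ennreal (1/a) * f x) * (ennreal (1/b) * g x))"
        by (simp only: ac_simps)
      also have "\<dots> \<le> ennreal (a * b) * (ennreal (1/s) * ennpowr (ennreal (1/a) * f x) s
         + ennreal (1/t) * ennpowr (ennreal (1/b) * g x) t)"
        using st by (intro mult_left_mono ennreal_Youngs_inequality) auto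
      finally show ?thesis using a b by (simp add: ennpowr_mult ennpowr_ennreal)
    qed
    have one: "ennreal ((1/c) powr r) * ennreal (c powr r) = 1" if "c > 0" for c r
      using that by (simp add: ennreal_mult[symmetric] powr_mult[symmetric])
    have "(\<integral>\<^sup>+x. f x * g x \<partial>lebesgue_on A) \<le>
      (\<integral>\<^sup>+x. ennreal (a * b) * (ennreal (1/s) * (ennreal ((1/a) powr s) * ennpowr (f x) s)
        + ennreal (1/t) * (ennreal ((1/b) powr t) * ennpowr (g x) t)) \<partial>lebesgue_on A)"
      by (rule nn_integral_mono) (rule bd)
    also have "\<dots> = ennreal (a * b) * (ennreal (1/s) * (ennreal ((1/a) powr s) * ennreal (a powr s))
        + ennreal (1/t) * (ennreal ((1/b) powr t) * ennreal (b powr t)))"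
      by (simp add: nn_integral_cmult nn_integral_add F G)
    also have "\<dots> = ennreal (a * b)"
      using a b st by (simp add: one ennreal_plus[symmetric] del: ennreal_plus)
    finally show ?thesis using a b by (simp add: ennreal_mult)
  qed
  then show ?thesis by (simp add: M_def t_def)
qed

section \<open>Primitives of nonnegative functions\<close>

text \<open>Both the majorant \<open>\<integral>\<^sub>0\<^sup>x t\<^sup>k |f(t)| dt\<close> of the Hardy operator and the dual integrals of the weight have this
form. All that is needed about them is that they are continuous, nondecreasing and start at \<open>0\<close>.\<close>

definition primitive :: "(real \<Rightarrow> ennreal) \<Rightarrow> real \<Rightarrow> ennreal" where
  "primitive h s = (\<integral>\<^sup>+x. h x \<partial>lebesgue_on {0<..<s})"

lemma borel_measurable_lebesgue_on_mono:
  "A \<subseteq> B \<Longrightarrow> f \<in> borel_measurable (lebesgue_on B) \<Longrightarrow> f \<in> borel_measurable (lebesgue_on A)"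
  by (rule measurable_restrict_mono)

lemma AE_lebesgue_on_mono:
  assumes "A \<subseteq> B" "A \<in> sets lebesgue" "B \<in> sets lebesgue" "AE x in lebesgue_on B. P x"
  shows "AE x in lebesgue_on A. P x"
  using assms by (auto simp: AE_restrict_space_iff elim!: eventually_mono)

lemma nn_integral_lebesgue_on_mono:
  assumes "A \<subseteq> B" "A \<in> sets lebesgue" "B \<in> sets lebesgue"
  shows "(\<integral>\<^sup>+x. h x \<partial>lebesgue_on A) \<le> (\<integral>\<^sup>+x. h x \<partial>lebesgue_on B)"
  using assms by (auto simp: nn_integral_restrict_space intro!: nn_integral_mono split: split_indicator)

lemma nn_integral_lebesgue_on_Un:
  assumes "A \<inter> B = {}" "A \<in> sets lebesgue" "B \<in> sets lebesgue"
    "h \<in> borel_measurable (lebesgue_on (A \<union> B))"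
  shows "(\<integral>\<^sup>+x. h x \<partial>lebesgue_on (A \<union> B)) =
    (\<integral>\<^sup>+x. h x \<partial>lebesgue_on A) + (\<integral>\<^sup>+x. h x \<partial>lebesgue_on B)"
proof -
  have m: "(\<lambda>x. h x * indicator A x) \<in> borel_measurable lebesgue"
     "(\<lambda>x. h x * indicator B x) \<in> borel_measurable lebesgue"
    using assms borel_measurable_lebesgue_on_mono[OF _ assms(4), of A]
      borel_measurable_lebesgue_on_mono[OF _ assms(4), of B]
    by (auto simp: borel_measurable_restrict_space_iff_ennreal mult.commute)
  have "(\<integral>\<^sup>+x. h x \<partial>lebesgue_on (A \<union> B)) =
    (\<integral>\<^sup>+x. h x * indicator A x + h x * indicator B x \<partial>lebesgue)"
    using assms by (auto simp: nn_integral_restrict_space intro!: nn_integral_cong split: split_indicator)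
  also have "\<dots> = (\<integral>\<^sup>+x. h x * indicator A x \<partial>lebesgue) + (\<integral>\<^sup>+x. h x * indicator B x \<partial>lebesgue)"
    using m by (rule nn_integral_add)
  finally show ?thesis using assms by (simp add: nn_integral_restrict_space)
qed

lemma primitive_mono: "s \<le> t \<Longrightarrow> primitive h s \<le> primitive h t"
  unfolding primitive_def by (rule nn_integral_lebesgue_on_mono) auto

lemma primitive_split:
  assumes "h \<in> borel_measurable (lebesgue_on {0<..})" "0 < s" "s \<le> t"
  shows "primitive h t = primitive h s + (\<integral>\<^sup>+x. h x \<partial>lebesgue_on {s..<t})"
proof -
  have "{0<..<t} = {0<..<s} \<union> {s..<t}" using assms by auto
  moreover have "h \<in> borel_measurable (lebesgue_on ({0<..<s} \<union> {s..<t}))"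
    using assms by (intro borel_measurable_lebesgue_on_mono[OF _ assms(1)]) auto
  ultimately show ?thesis
    unfolding primitive_def by (auto intro!: nn_integral_lebesgue_on_Un)
qed

lemma primitive_cong_pos:
  assumes "\<And>x. 0 < x \<Longrightarrow> g x = h x" shows "primitive g r = primitive h r"
  unfolding primitive_def using assms by (intro nn_integral_cong) (simp add: space_restrict_space)

text \<open>The Lebesgue integral over \<open>(0, x)\<close> agrees with the gauge integral over \<open>[0, x]\<close>, whose
dependence on the upper end point is continuous.\<close>

lemma continuous_on_integral_upto:
  fixes f :: "real \<Rightarrow> 'a::euclidean_space"
  assumes "\<And>r. 0 < r \<Longrightarrow> integrable (lebesgue_on {0<..<r}) f"
  shows "continuous_on {0..} (\<lambda>x. LINT t|lebesgue_on {0<..<x}. f t)"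
proof (unfold continuous_on_eq_continuous_within, intro ballI)
  fix x :: real assume x: "x \<in> {0..}"
  define r where "r = x + 1"
  have r: "0 < r" "x < r" using x by (auto simp: r_def)
  have int: "integrable (lebesgue_on {0<..<s}) f" if "s \<le> r" for s
  proof -
    have "{0<..<s} \<subseteq> {0<..<r}" using that by auto
    from assms[OF r(1)] have "set_integrable lebesgue {0<..<r} f"
      by (simp add: set_integrable_def integrable_restrict_space)
    then have "set_integrable lebesgue {0<..<s} f"
      by (rule set_integrable_subset) (use that in auto)
    then show ?thesis by (simp add: set_integrable_def integrable_restrict_space)
  qed
  have eq: "(LINT t|lebesgue_on {0<..<s}. f t) = integral {0..s} f" if "s \<le> r" for s
    using lebesgue_integral_eq_integral[OF int[OF that]] by (simp add: integral_open_interval_real)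
  have "f integrable_on {0<..<r}"
    using integrable_on_lebesgue_on[OF int[of r]] by simp
  then have "continuous_on {0..r} (\<lambda>s. integral {0..s} f)"
    by (intro indefinite_integral_continuous_1) (simp add: integrable_on_open_interval_real)
  then have "continuous_on {0..r} (\<lambda>s. LINT t|lebesgue_on {0<..<s}. f t)"
    by (rule continuous_on_eq) (simp add: eq)
  then have "continuous (at x within {0..r}) (\<lambda>s. LINT t|lebesgue_on {0<..<s}. f t)"
    using x r by (simp add: continuous_on_eq_continuous_within)
  moreover have "at x within {0..r} = at x within {0..}"
    by (rule at_within_nhd[of x "{..<r}"]) (use r in auto)
  ultimately show "continuous (at x within {0..}) (\<lambda>s. LINT t|lebesgue_on {0<..<s}. f t)"
    by simp
qed

lemma primitive_continuous:
  assumes h: "h \<in> borel_measurable (lebesgue_on {0<..})"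
    and fin: "\<And>r. 0 < r \<Longrightarrow> primitive h r < top"
  obtains G :: "real \<Rightarrow> real" where "continuous_on {0..} G" "G 0 = 0" "\<And>s. 0 \<le> G s"
    "\<And>s. primitive h s = ennreal (G s)"
proof
  let ?G = "\<lambda>s. LINT t|lebesgue_on {0<..<s}. enn2real (h t)"
  have m: "h \<in> borel_measurable (lebesgue_on {0<..<s})" for s
    by (rule borel_measurable_lebesgue_on_mono[OF _ h]) auto
  have eq: "(\<integral>\<^sup>+x. ennreal (enn2real (h x)) \<partial>lebesgue_on {0<..<s}) = primitive h s" for s
  proof (cases "0 < s")
    case True
    have "AE x in lebesgue_on {0<..<s}. h x \<noteq> \<infinity>"
      using fin[OF True] by (intro nn_integral_PInf_AE[OF m]) (auto simp: primitive_def)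
    then have "AE x in lebesgue_on {0<..<s}. ennreal (enn2real (h x)) = h x"
      by eventually_elim (auto simp: less_top)
    then show ?thesis unfolding primitive_def by (rule nn_integral_cong_AE)
  next
    case False
    then have "{0<..<s} = {}" by auto
    then show ?thesis by (simp add: primitive_def nn_integral_restrict_space)
  qed
  have int: "integrable (lebesgue_on {0<..<s}) (\<lambda>x. enn2real (h x))" for s
  proof (cases "0 < s")
    case True
    then show ?thesis using m[of s] fin[OF True] eq[of s] by (intro integrableI_nonneg) auto
  next
    case False
    then have "{0<..<s} = {}" by auto
    then show ?thesis by (simp add: integrable_restrict_space)
  qed
  show "continuous_on {0..} ?G" by (rule continuous_on_integral_upto) (rule int)
  show "?G 0 = 0" by (simp add: integral_restrict_space)
  show "0 \<le> ?G s" for s by simp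
  show "primitive h s = ennreal (?G s)" for s
    using nn_integral_eq_integral[OF int[of s]] eq[of s] by simp
qed

lemma primitive_measurable:
  assumes "h \<in> borel_measurable (lebesgue_on {0<..})"
    and "\<And>r. 0 < r \<Longrightarrow> primitive h r < top"
  shows "primitive h \<in> borel_measurable (lebesgue_on {0<..})"
proof -
  obtain G where G: "continuous_on {0..} G" "\<And>s. primitive h s = ennreal (G s)"
    using primitive_continuous[OF assms] by metis
  have "continuous_on {0<..} G" by (rule continuous_on_subset[OF G(1)]) auto
  then have "G \<in> borel_measurable (lebesgue_on {0<..})"
    by (rule continuous_imp_measurable_on_sets_lebesgue) auto
  then show ?thesis using G(2) by (simp add: fun_eq_iff[symmetric] cong: measurable_cong)
qed

lemma primitive_IVT:
  assumes "h \<in> borel_measurable (lebesgue_on {0<..})"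
    and "\<And>r. 0 < r \<Longrightarrow> primitive h r < top"
    and "0 < r" "0 < y" "ennreal y < primitive h r"
  obtains s where "0 < s" "s < r" "primitive h s = ennreal y"
proof -
  obtain G where G: "continuous_on {0..} G" "G 0 = 0" "\<And>s. 0 \<le> G s" "\<And>s. primitive h s = ennreal (G s)"
    using primitive_continuous[OF assms(1,2)] by metis
  have y: "y < G r" using assms G by (simp add: ennreal_less_iff)
  have "continuous_on {0..r} G" by (rule continuous_on_subset[OF G(1)]) auto
  then obtain s where s: "0 \<le> s" "s \<le> r" "G s = y"
    using IVT'[of G 0 y r] y assms G by auto
  have "s \<noteq> 0" "s \<noteq> r" using s G assms y by auto
  then show ?thesis using s G by (intro that[of s]) auto
qed

text \<open>\<open>R\<close> is the set of \<open>i\<close> for which the primitive attains the value \<open>2\<^sup>i\<close>, and \<open>X i\<close> is a point where it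
does. As the primitive starts at \<open>0\<close>, \<open>R\<close> is closed downwards. A point where the value lies in
\<open>(2\<^sup>i, 2\<^sup>i\<^sup>+\<^sup>1]\<close> lies to the right of \<open>X i\<close>.\<close>

lemma dyadic_level_points:
  assumes h: "h \<in> borel_measurable (lebesgue_on {0<..})"
    and fin: "\<And>r. 0 < r \<Longrightarrow> primitive h r < top"
  obtains R :: "int set" and X :: "int \<Rightarrow> real" where
    "\<And>i. i \<in> R \<Longrightarrow> 0 < X i \<and> primitive h (X i) = ennreal (2 powr real_of_int i)"
    "\<And>i. i \<in> R \<Longrightarrow> i - 1 \<in> R"
    "\<And>x. 0 < x \<Longrightarrow> primitive h x \<noteq> 0 \<Longrightarrow>
       \<exists>i\<in>R. X i < x \<and> primitive h x \<le> ennreal (2 powr (real_of_int i + 1))"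
proof -
  define R where "R = {i::int. \<exists>x>0. primitive h x = ennreal (2 powr real_of_int i)}"
  define X where "X i = (SOME x. x > 0 \<and> primitive h x = ennreal (2 powr real_of_int i))" for i :: int
  have X: "0 < X i \<and> primitive h (X i) = ennreal (2 powr real_of_int i)" if "i \<in> R" for i
    using that unfolding R_def X_def mem_Collect_eq by (rule someI_ex)
  show ?thesis
  proof (rule that[of R X])
    show "0 < X i \<and> primitive h (X i) = ennreal (2 powr real_of_int i)" if "i \<in> R" for i
      using X[OF that] .
    show "i - 1 \<in> R" if iR: "i \<in> R" for i
    proof -
      have "ennreal (2 powr real_of_int (i - 1)) < primitive h (X i)"
        using X[OF iR] by (simp add: ennreal_less_iff)
      then obtain s where "0 < s" "primitive h s = ennreal (2 powr real_of_int (i - 1))"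
        using primitive_IVT[OF h fin, of "X i" "2 powr real_of_int (i - 1)"] X[OF iR] by auto
      then show ?thesis by (auto simp: R_def)
    qed
    fix x :: real assume x: "0 < x" "primitive h x \<noteq> 0"
    obtain y where y: "primitive h x = ennreal y" "0 < y"
      using fin[OF x(1)] x(2) by (cases "primitive h x") (auto simp: ennreal_eq_0_iff)
    define i where "i = \<lceil>log 2 y\<rceil> - 1"
    have i: "real_of_int i < log 2 y" "log 2 y \<le> real_of_int i + 1"
      unfolding i_def by linarith+
    have lo: "2 powr real_of_int i < y" and hi: "y \<le> 2 powr (real_of_int i + 1)"
      using i y by (auto simp: less_log_iff log_le_iff)
    have lo': "ennreal (2 powr real_of_int i) < primitive h x"
      using y lo by (simp add: ennreal_less_iff)
    then obtain s where "0 < s" "primitive h s = ennreal (2 powr real_of_int i)"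
      using primitive_IVT[OF h fin x(1), of "2 powr real_of_int i"] by auto
    then have iR: "i \<in> R" by (auto simp: R_def)
    have "X i < x"
    proof (rule ccontr)
      assume "\<not> X i < x"
      then have "primitive h x \<le> primitive h (X i)" by (intro primitive_mono) auto
      then show False using lo' X[OF iR] by auto
    qed
    then show "\<exists>i\<in>R. X i < x \<and> primitive h x \<le> ennreal (2 powr (real_of_int i + 1))"
      using iR y hi by (auto simp: ennreal_leI)
  qed
qed

text \<open>This is the embedding of \<open>\<ell>\<^sub>1\<close> into \<open>\<ell>\<^sub>s\<close>; for finite \<open>q\<close> it is where the assumption \<open>p \<le> q\<close> enters.\<close>

lemma suminf_ennpowr_le:
  fixes a :: "nat \<Rightarrow> ennreal"
  assumes "1 \<le> s"
  shows "(\<Sum>i. ennpowr (a i) s) \<le> ennpowr (\<Sum>i. a i) s"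
proof -
  define T where "T = (\<Sum>i. a i)"
  have le: "a i \<le> T" for i unfolding T_def
    using sum_le_suminf[of a "{i}"] by simp
  have "ennpowr (a i) s \<le> a i * ennpowr T (s - 1)" for i
  proof -
    have "ennpowr (a i) s = a i * ennpowr (a i) (s - 1)"
      using ennpowr_add[of "a i" 1 "s - 1"] by simp
    also have "\<dots> \<le> a i * ennpowr T (s - 1)"
      using assms le by (intro mult_left_mono ennpowr_mono) auto
    finally show ?thesis .
  qed
  then have "(\<Sum>i. ennpowr (a i) s) \<le> (\<Sum>i. a i * ennpowr T (s - 1))"
    by (intro suminf_le) auto
  also have "\<dots> = ennpowr T s"
    using ennpowr_add[of T 1 "s - 1"] by (simp add: T_def)
  finally show ?thesis by (simp add: T_def)
qed

section \<open>The two-weight Hardy inequality\<close>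

lemma ident_measurable_pos [measurable]:
  "(\<lambda>x::real. x) \<in> borel_measurable (lebesgue_on {0<..})"
  by (rule continuous_imp_measurable_on_sets_lebesgue) auto

lemma powr_measurable_pos [measurable]:
  "(\<lambda>x::real. x powr c) \<in> borel_measurable (lebesgue_on {0<..})"
  by (rule continuous_imp_measurable_on_sets_lebesgue) (auto intro!: continuous_intros)

lemma nn_integral_Hoelder_primitive:
  assumes p: "1 < p" and A: "A \<subseteq> {0<..<r}" "A \<in> sets lebesgue"
    and phi: "phi \<in> borel_measurable (lebesgue_on {0<..})"
    and om: "om \<in> borel_measurable (lebesgue_on {0<..})"
  shows "(\<integral>\<^sup>+x. phi x * om x \<partial>lebesgue_on A) \<le> lp_norm p A phi *
    ennpowr (primitive (\<lambda>x. ennpowr (om x) (conj_exp p)) r) (1 / conj_exp p)"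
proof -
  have sub: "A \<subseteq> {0<..}" using A by auto
  have "(\<integral>\<^sup>+x. phi x * om x \<partial>lebesgue_on A) \<le> lp_norm p A phi *
      ennpowr (\<integral>\<^sup>+x. ennpowr (om x) (conj_exp p) \<partial>lebesgue_on A) (1 / conj_exp p)"
    by (intro lp_norm_Hoelder p borel_measurable_lebesgue_on_mono[OF sub phi]
        borel_measurable_lebesgue_on_mono[OF sub om])
  also have "\<dots> \<le> lp_norm p A phi *
      ennpowr (primitive (\<lambda>x. ennpowr (om x) (conj_exp p)) r) (1 / conj_exp p)"
    unfolding primitive_def using A conj_exp_pos[OF p]
    by (intro mult_left_mono ennpowr_mono nn_integral_lebesgue_on_mono) auto
  finally show ?thesis .
qed

lemma primitive_Hoelder:
  assumes p: "1 < p"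
    and phi: "phi \<in> borel_measurable (lebesgue_on {0<..})"
    and om: "om \<in> borel_measurable (lebesgue_on {0<..})"
  shows "primitive (\<lambda>t. phi t * om t) r \<le> lp_norm p {0<..} phi *
    ennpowr (primitive (\<lambda>x. ennpowr (om x) (conj_exp p)) r) (1 / conj_exp p)"
proof -
  have "primitive (\<lambda>t. phi t * om t) r \<le> lp_norm p {0<..<r} phi *
      ennpowr (primitive (\<lambda>x. ennpowr (om x) (conj_exp p)) r) (1 / conj_exp p)"
    unfolding primitive_def[of "\<lambda>t. phi t * om t"]
    by (rule nn_integral_Hoelder_primitive[OF p _ _ phi om]) auto
  also have "\<dots> \<le> lp_norm p {0<..} phi *
      ennpowr (primitive (\<lambda>x. ennpowr (om x) (conj_exp p)) r) (1 / conj_exp p)"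
    by (intro mult_right_mono lp_norm_subset p) auto
  finally show ?thesis .
qed

text \<open>The sufficiency half of the Muckenhoupt--Bradley theorem, with the constant \<open>4\<close> for all exponents.
Let \<open>H\<close> be the primitive of \<open>phi * om\<close> and \<open>X i\<close> a point with \<open>H (X i) = 2\<^sup>i\<close>. Where
\<open>2\<^sup>i < H \<le> 2\<^sup>i\<^sup>+\<^sup>1\<close>, the value of \<open>H\<close> is at most four times the increment \<open>2\<^sup>i\<^sup>-\<^sup>1\<close> of \<open>H\<close> over the
preceding block \<open>J i = [X (i - 1), X i)\<close>. By Hoelder's inequality this increment is at most
\<open>c i * W (X i)\<close>, with \<open>c i\<close> the norm of \<open>phi\<close> on \<open>J i\<close> and \<open>W r\<close> the dual factor at \<open>r\<close>.
Since the point lies to the right of \<open>X i\<close>, the norm of \<open>b\<close> there is controlled by \<open>S / W (X i)\<close>,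
and the factor \<open>W (X i)\<close> cancels. The blocks are disjoint, so \<open>\<Sum>i. (c i)\<^sup>p\<close> is at most the \<open>p\<close>-th
power of the norm of \<open>phi\<close>, and \<open>\<Sum>i. (c i)\<^sup>q \<le> (\<Sum>i. (c i)\<^sup>p) powr (q / p)\<close> because \<open>p \<le> q\<close>.\<close>

proposition weighted_hardy_inequality:
  fixes b phi om :: "real \<Rightarrow> ennreal"
  assumes p: "1 < p" and q: "p \<le> q"
    and b[measurable]: "b \<in> borel_measurable (lebesgue_on {0<..})"
    and phi[measurable]: "phi \<in> borel_measurable (lebesgue_on {0<..})"
    and om[measurable]: "om \<in> borel_measurable (lebesgue_on {0<..})"
    and W_fin: "\<And>r. 0 < r \<Longrightarrow> primitive (\<lambda>x. ennpowr (om x) (conj_exp p)) r < top"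
    and N_fin: "lp_norm p {0<..} phi < top"
    and S: "\<And>r. 0 < r \<Longrightarrow> lp_norm q {r<..} b *
       ennpowr (primitive (\<lambda>x. ennpowr (om x) (conj_exp p)) r) (1 / conj_exp p) \<le> S"
  shows "lp_norm q {0<..} (\<lambda>x. b x * primitive (\<lambda>t. phi t * om t) x) \<le> 4 * S * lp_norm p {0<..} phi"
proof -
  define W where "W r = ennpowr (primitive (\<lambda>x. ennpowr (om x) (conj_exp p)) r) (1 / conj_exp p)" for r
  define H where "H = primitive (\<lambda>t. phi t * om t)"
  define N where "N = lp_norm p {0<..} phi"
  have q1: "1 < q" using p q by simp
  have Hoelder: "(\<integral>\<^sup>+x. phi x * om x \<partial>lebesgue_on A) \<le> lp_norm p A phi * W r"
    if "A \<subseteq> {0<..<r}" "A \<in> sets lebesgue" for A r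
    unfolding W_def by (rule nn_integral_Hoelder_primitive[OF p that phi om])
  have H_fin: "H r < top" if "0 < r" for r
  proof -
    have "H r \<le> N * W r"
      unfolding H_def N_def W_def by (rule primitive_Hoelder[OF p phi om])
    also have "\<dots> < top"
      using N_fin W_fin[OF that] by (simp add: N_def W_def ennreal_mult_less_top)
    finally show ?thesis .
  qed
  have Hm[measurable]: "H \<in> borel_measurable (lebesgue_on {0<..})"
    unfolding H_def by (rule primitive_measurable) (use H_fin in \<open>auto simp: H_def\<close>)
  have hm: "(\<lambda>t. phi t * om t) \<in> borel_measurable (lebesgue_on {0<..})" by measurable
  have hfin: "primitive (\<lambda>t. phi t * om t) r < top" if "0 < r" for r
    using H_fin[OF that] by (simp add: H_def)
  obtain R X where
    X: "\<And>i. i \<in> R \<Longrightarrow> 0 < X i \<and> H (X i) = ennreal (2 powr real_of_int i)"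
    and R: "\<And>i. i \<in> R \<Longrightarrow> i - 1 \<in> R"
    and RX: "\<And>x. 0 < x \<Longrightarrow> H x \<noteq> 0 \<Longrightarrow> \<exists>i\<in>R. X i < x \<and> H x \<le> ennreal (2 powr (real_of_int i + 1))"
    by (rule dyadic_level_points[OF hm hfin, folded H_def]) (assumption, rule that)
  have X_less: "X i < X j" if "i \<in> R" "j \<in> R" "i < j" for i j
  proof (rule ccontr)
    assume "\<not> X i < X j"
    then have "H (X j) \<le> H (X i)" unfolding H_def by (intro primitive_mono) auto
    moreover have "2 powr real_of_int i < 2 powr real_of_int j" using that by simp
    ultimately show False using X that by (simp add: ennreal_le_iff)
  qed
  define J where "J i = (if i \<in> R then {X (i - 1)..<X i} else {})" for i
  define c where "c i = lp_norm p (J i) phi" for i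
  have J_sets: "J i \<in> sets lebesgue" for i by (auto simp: J_def)
  have J_pos: "J i \<subseteq> {0<..<X i}" for i
  proof (cases "i \<in> R")
    case True
    then have "0 < X (i - 1)" using X R by blast
    then show ?thesis by (auto simp: J_def)
  qed (simp add: J_def)
  have J_pos': "J i \<subseteq> {0<..}" for i using J_pos[of i] by auto
  have J_disj: "disjoint_family J"
  proof -
    have *: "J i \<inter> J j = {}" if "i < j" for i j
    proof (cases "i \<in> R \<and> j \<in> R")
      case True
      then have "X i \<le> X (j - 1)"
        using X_less[of i "j - 1"] R that by (cases "i = j - 1") auto
      then show ?thesis using True by (auto simp: J_def)
    qed (auto simp: J_def)
    show ?thesis unfolding disjoint_family_on_def
    proof (intro ballI impI)
      fix i j :: int assume "i \<noteq> j"
      then show "J i \<inter> J j = {}" using *[of i j] *[of j i] by (cases "i < j") auto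
    qed
  qed
  have H_le: "H x \<le> 4 * (c i * W (X i))" if iR: "i \<in> R" and x: "H x \<le> ennreal (2 powr (real_of_int i + 1))" for i x
  proof -
    have "H (X i) = H (X (i - 1)) + (\<integral>\<^sup>+x. phi x * om x \<partial>lebesgue_on (J i))"
    proof -
      have "0 < X (i - 1)" "X (i - 1) < X i" using iR R X X_less[of "i - 1" i] by auto
      then show ?thesis
        using primitive_split[OF hm, of "X (i - 1)" "X i"] iR by (simp add: J_def H_def)
    qed
    then have eq: "ennreal (2 powr real_of_int i) = ennreal (2 powr (real_of_int i - 1)) +
        (\<integral>\<^sup>+x. phi x * om x \<partial>lebesgue_on (J i))"
      using X[OF iR] X[OF R[OF iR]] by simp
    have "2 powr real_of_int i - 2 powr (real_of_int i - 1) = 2 powr (real_of_int i - 1)"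
      by (simp add: powr_diff)
    then have "ennreal (2 powr (real_of_int i - 1)) = ennreal (2 powr real_of_int i) - ennreal (2 powr (real_of_int i - 1))"
      by (simp add: ennreal_minus)
    also have "\<dots> = (\<integral>\<^sup>+x. phi x * om x \<partial>lebesgue_on (J i))"
      unfolding eq by simp
    also have "\<dots> \<le> c i * W (X i)"
      unfolding c_def by (rule Hoelder[OF J_pos J_sets])
    finally have "4 * ennreal (2 powr (real_of_int i - 1)) \<le> 4 * (c i * W (X i))"
      by (rule mult_left_mono) simp
    moreover have "4 * ennreal (2 powr (real_of_int i - 1)) = ennreal (2 powr (real_of_int i + 1))"
    proof -
      have "2 powr (real_of_int i + 1) = 4 * 2 powr (real_of_int i - 1)"
        by (simp add: powr_add powr_diff)
      then show ?thesis by (simp add: ennreal_mult)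
    qed
    ultimately show ?thesis using x by simp
  qed
  have bH: "b x * H x = 0 \<or> (\<exists>i\<in>R. X i < x \<and> b x * H x \<le> 4 * (c i * W (X i)) * b x)" if x: "0 < x" for x
  proof (cases "H x = 0")
    case False
    then obtain i where i: "i \<in> R" "X i < x" "H x \<le> ennreal (2 powr (real_of_int i + 1))"
      using RX[OF x] by auto
    have "b x * H x \<le> b x * (4 * (c i * W (X i)))"
      using H_le[OF i(1,3)] by (rule mult_left_mono) simp
    then show ?thesis using i by (auto simp: mult.commute)
  qed simp
  have SW: "lp_norm q {X i<..} b * W (X i) \<le> S" if "i \<in> R" for i
    using S[of "X i"] X[OF that] by (simp add: W_def)
  have bHm: "(\<lambda>x. b x * H x) \<in> borel_measurable (lebesgue_on {0<..})" by measurable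
  have "lp_norm q {0<..} (\<lambda>x. b x * H x) \<le> 4 * S * N"
  proof (cases "q = \<infinity>")
    case True
    have "AE x in lebesgue_on {0<..}. \<forall>i\<in>R. X i < x \<longrightarrow> b x \<le> lp_norm q {X i<..} b"
    proof -
      have "AE x in lebesgue. \<forall>i\<in>R. X i < x \<longrightarrow> b x \<le> lp_norm q {X i<..} b"
      proof (subst AE_ball_countable)
        show "\<forall>i\<in>R. AE x in lebesgue. X i < x \<longrightarrow> b x \<le> lp_norm q {X i<..} b"
        proof
          fix i
          have "AE x in lebesgue_on {X i<..}. b x \<le> lp_norm q {X i<..} b"
            using esssup_AE[of b "lebesgue_on {X i<..}"] by (simp add: True lp_norm_infinity)
          then show "AE x in lebesgue. X i < x \<longrightarrow> b x \<le> lp_norm q {X i<..} b"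
            by (simp add: AE_restrict_space_iff)
        qed
      qed simp
      then show ?thesis by (auto simp: AE_restrict_space_iff elim!: eventually_mono)
    qed
    moreover have "AE x in lebesgue_on {0<..}. 0 < x"
      by (rule AE_I2) (simp add: space_restrict_space)
    ultimately have "AE x in lebesgue_on {0<..}. b x * H x \<le> 4 * S * N"
    proof eventually_elim
      case (elim x)
      from bH[OF elim(2)] show ?case
      proof
        assume "\<exists>i\<in>R. X i < x \<and> b x * H x \<le> 4 * (c i * W (X i)) * b x"
        then obtain i where i: "i \<in> R" "X i < x" "b x * H x \<le> 4 * (c i * W (X i)) * b x" by auto
        have "b x * H x \<le> 4 * (c i * W (X i)) * lp_norm q {X i<..} b"
          using i(3) elim(1) i(1,2) by (meson mult_left_mono order_trans zero_le)
        also have "\<dots> = 4 * c i * (lp_norm q {X i<..} b * W (X i))"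
          by (simp only: ac_simps)
        also have "\<dots> \<le> 4 * N * S"
          unfolding c_def N_def using SW[OF i(1)] J_pos' J_sets
          by (intro mult_mono lp_norm_subset p) auto
        finally show ?case by (simp only: ac_simps)
      qed auto
    qed
    then show ?thesis using bHm by (auto simp: True lp_norm_infinity)
  next
    case False
    then have pfin: "p \<noteq> \<infinity>" using q by (auto simp: top_unique)
    define P Q where "P = enn2real p" and "Q = enn2real q"
    have P: "1 < P" using enn2real_gt_1[OF p pfin] by (simp add: P_def)
    have PQ: "P \<le> Q"
      using q False pfin by (auto simp: P_def Q_def less_top intro!: enn2real_mono)
    have Q: "1 < Q" using P PQ by simp
    \<comment> \<open>The half lines to the right of the \<open>X i\<close> overlap, but summing over all of them is harmless:
      for each point one of the summands dominates.\<close>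
    define F where "F i x = (if i \<in> R then ennpowr (4 * (c i * W (X i))) Q * (ennpowr (b x) Q * indicator {X i<..} x) else 0)" for i x
    have Fm: "(\<lambda>x. F i x) \<in> borel_measurable (lebesgue_on {0<..})" for i
    proof -
      have sets: "{X i<..} \<inter> {0<..} \<in> sets (lebesgue_on {0<..})"
        by (auto simp: sets_restrict_space)
      have ind: "(\<lambda>x. indicator {X i<..} x :: ennreal) \<in> borel_measurable (lebesgue_on {0<..})"
      proof (intro borel_measurable_indicator')
        have eq: "{x \<in> space (lebesgue_on {0<..}). x \<in> {X i<..}} = {X i<..} \<inter> {0<..}"
          by (auto simp: space_restrict_space)
        show "{x \<in> space (lebesgue_on {0<..}). x \<in> {X i<..}} \<in> sets (lebesgue_on {0<..})"
          unfolding eq by (rule sets)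
      qed
      have "(\<lambda>x. ennpowr (4 * (c i * W (X i))) Q * (ennpowr (b x) Q * indicator {X i<..} x))
          \<in> borel_measurable (lebesgue_on {0<..})"
        by (intro borel_measurable_times_ennreal borel_measurable_const ennpowr_measurable_comp b ind)
      then show ?thesis by (cases "i \<in> R") (simp_all add: F_def)
    qed
    have pt: "ennpowr (b x * H x) Q \<le> (\<Sum>k. F (int_decode k) x)" if x: "0 < x" for x
      using bH[OF x]
    proof
      assume "\<exists>i\<in>R. X i < x \<and> b x * H x \<le> 4 * (c i * W (X i)) * b x"
      then obtain i where i: "i \<in> R" "X i < x" "b x * H x \<le> 4 * (c i * W (X i)) * b x" by auto
      then have "ennpowr (b x * H x) Q \<le> F i x"
        using Q ennpowr_mono[OF _ i(3), of Q] by (simp add: F_def ennpowr_mult)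
      also have "\<dots> = F (int_decode (int_encode i)) x" by simp
      also have "\<dots> \<le> (\<Sum>k. F (int_decode k) x)"
        using sum_le_suminf[of "\<lambda>k. F (int_decode k) x" "{int_encode i}"] by simp
      finally show ?thesis .
    qed auto
    have intF: "(\<integral>\<^sup>+x. F i x \<partial>lebesgue_on {0<..}) \<le> ennpowr (4 * S) Q * ennpowr (c i) Q" for i
    proof (cases "i \<in> R")
      case True
      have "(\<integral>\<^sup>+x. ennpowr (b x) Q * indicator {X i<..} x \<partial>lebesgue_on {0<..}) =
         (\<integral>\<^sup>+x. ennpowr (b x) Q \<partial>lebesgue_on {X i<..})"
        using X[OF True] by (auto simp: nn_integral_restrict_space intro!: nn_integral_cong split: split_indicator)
      also have "\<dots> = ennpowr (lp_norm q {X i<..} b) Q"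
        using ennpowr_lp_norm[OF q1 False] by (simp add: Q_def)
      finally have "(\<integral>\<^sup>+x. F i x \<partial>lebesgue_on {0<..}) =
          ennpowr (4 * (c i * W (X i))) Q * ennpowr (lp_norm q {X i<..} b) Q"
        using True by (simp add: F_def nn_integral_cmult)
      also have "\<dots> = ennpowr (4 * (lp_norm q {X i<..} b * W (X i))) Q * ennpowr (c i) Q"
        by (simp only: ennpowr_mult ac_simps)
      also have "\<dots> \<le> ennpowr (4 * S) Q * ennpowr (c i) Q"
        using SW[OF True] Q by (intro mult_right_mono ennpowr_mono mult_left_mono) auto
      finally show ?thesis .
    qed (simp add: F_def)
    have cP: "ennpowr (c i) P = (\<integral>\<^sup>+x. ennpowr (phi x) P * indicator (J i) x \<partial>lebesgue_on {0<..})" for i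
    proof -
      have "ennpowr (c i) P = (\<integral>\<^sup>+x. ennpowr (phi x) P \<partial>lebesgue_on (J i))"
        using ennpowr_lp_norm[OF p pfin] by (simp add: P_def c_def)
      then show ?thesis using J_pos'[of i] J_sets[of i]
        by (auto simp: nn_integral_restrict_space intro!: nn_integral_cong split: split_indicator)
    qed
    have "(\<Sum>k. ennpowr (c (int_decode k)) P) =
       (\<integral>\<^sup>+x. (\<Sum>k. ennpowr (phi x) P * indicator (J (int_decode k)) x) \<partial>lebesgue_on {0<..})"
    proof -
      have "(\<lambda>x. ennpowr (phi x) P * indicator (J i) x) \<in> borel_measurable (lebesgue_on {0<..})" for i
        by (intro borel_measurable_times_ennreal ennpowr_measurable_comp phi borel_measurable_indicator')
          (use J_sets[of i] in \<open>auto simp: sets_restrict_space\<close>)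
      then show ?thesis unfolding cP by (subst nn_integral_suminf) auto
    qed
    also have "\<dots> \<le> (\<integral>\<^sup>+x. ennpowr (phi x) P \<partial>lebesgue_on {0<..})"
    proof (rule nn_integral_mono)
      fix x :: real
      have "disjoint_family (\<lambda>k. J (int_decode k))"
        using J_disj by (auto simp: disjoint_family_on_def int_decode_eq)
      then have "(\<Sum>k. indicator (J (int_decode k)) x :: ennreal) = indicator (\<Union>k. J (int_decode k)) x"
        by (rule suminf_indicator)
      also have "\<dots> \<le> 1" by (simp split: split_indicator)
      finally have "ennpowr (phi x) P * (\<Sum>k. indicator (J (int_decode k)) x) \<le> ennpowr (phi x) P * 1"
        by (rule mult_left_mono) simp
      then show "(\<Sum>k. ennpowr (phi x) P * indicator (J (int_decode k)) x) \<le> ennpowr (phi x) P"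
        by simp
    qed
    also have "\<dots> = ennpowr N P"
      using ennpowr_lp_norm[OF p pfin] by (simp add: P_def N_def)
    finally have sumP: "(\<Sum>k. ennpowr (c (int_decode k)) P) \<le> ennpowr N P" .
    have "(\<Sum>k. ennpowr (c (int_decode k)) Q) = (\<Sum>k. ennpowr (ennpowr (c (int_decode k)) P) (Q / P))"
      using P by (simp add: ennpowr_ennpowr)
    also have "\<dots> \<le> ennpowr (\<Sum>k. ennpowr (c (int_decode k)) P) (Q / P)"
      using P PQ by (intro suminf_ennpowr_le) simp
    also have "\<dots> \<le> ennpowr (ennpowr N P) (Q / P)"
      using sumP P Q by (intro ennpowr_mono) auto
    also have "\<dots> = ennpowr N Q" using P by (simp add: ennpowr_ennpowr)
    finally have sumQ: "(\<Sum>k. ennpowr (c (int_decode k)) Q) \<le> ennpowr N Q" .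
    have "ennpowr (lp_norm q {0<..} (\<lambda>x. b x * H x)) Q = (\<integral>\<^sup>+x. ennpowr (b x * H x) Q \<partial>lebesgue_on {0<..})"
      using ennpowr_lp_norm[OF q1 False] by (simp add: Q_def)
    also have "\<dots> \<le> (\<integral>\<^sup>+x. (\<Sum>k. F (int_decode k) x) \<partial>lebesgue_on {0<..})"
      by (rule nn_integral_mono) (auto simp: space_restrict_space intro!: pt)
    also have "\<dots> = (\<Sum>k. \<integral>\<^sup>+x. F (int_decode k) x \<partial>lebesgue_on {0<..})"
      by (rule nn_integral_suminf) (rule Fm)
    also have "\<dots> \<le> (\<Sum>k. ennpowr (4 * S) Q * ennpowr (c (int_decode k)) Q)"
      by (rule suminf_le) (auto intro: intF)
    also have "\<dots> \<le> ennpowr (4 * S) Q * ennpowr N Q"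
      using sumQ by (simp add: mult_left_mono)
    also have "\<dots> = ennpowr (4 * S * N) Q" by (simp add: ennpowr_mult)
    finally show ?thesis using Q by (simp add: ennpowr_le_iff)
  qed
  then show ?thesis by (simp add: H_def N_def)
qed

section \<open>Dual bases for moments\<close>

text \<open>A square system whose transpose has trivial kernel is invertible, and a right inverse of a square
matrix is a left inverse.\<close>

lemma square_system_inverse:
  fixes y :: "nat \<Rightarrow> nat \<Rightarrow> real"
  assumes inj: "\<And>c. \<forall>i\<le>n. (\<Sum>k\<le>n. c k * y k i) = 0 \<Longrightarrow> \<forall>k\<le>n. c k = 0"
  obtains B :: "nat \<Rightarrow> nat \<Rightarrow> real" where
    "\<And>k j. k \<le> n \<Longrightarrow> j \<le> n \<Longrightarrow> (\<Sum>i\<le>n. y k i * B i j) = (if k = j then 1 else 0)"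
    "\<And>i l. i \<le> n \<Longrightarrow> l \<le> n \<Longrightarrow> (\<Sum>k\<le>n. B i k * y k l) = (if i = l then 1 else 0)"
proof -
  define A where "A = Matrix.mat (Suc n) (Suc n) (\<lambda>(k, i). y k i)"
  have A: "A \<in> carrier_mat (Suc n) (Suc n)" by (simp add: A_def)
  have sum_eq: "(\<Sum>k = 0..<Suc n. f k) = (\<Sum>k\<le>n. f k)" for f :: "nat \<Rightarrow> real"
    by (rule sum.cong) auto
  have "Determinant.det A \<noteq> 0"
  proof
    assume "Determinant.det A = 0"
    then have "Determinant.det (transpose_mat A) = 0"
      using Determinant.det_transpose[OF A] by simp
    then obtain v where v: "v \<in> carrier_vec (Suc n)" "v \<noteq> 0\<^sub>v (Suc n)"
      "transpose_mat A *\<^sub>v v = 0\<^sub>v (Suc n)"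
      using det_0_iff_vec_prod_zero[of "transpose_mat A" "Suc n"] A by auto
    have "(\<Sum>k\<le>n. vec_index v k * y k i) = 0" if "i \<le> n" for i
    proof -
      have "vec_index (transpose_mat A *\<^sub>v v) i = 0" using v that by simp
      moreover have "vec_index (transpose_mat A *\<^sub>v v) i = (\<Sum>k = 0..<Suc n. y k i * vec_index v k)"
        using that v(1) A by (auto simp: scalar_prod_def A_def intro!: sum.cong)
      ultimately show ?thesis unfolding sum_eq by (simp add: mult.commute)
    qed
    then have "\<forall>k\<le>n. vec_index v k = 0"
      using inj[of "vec_index v"] by blast
    then have "v = 0\<^sub>v (Suc n)" using v by (intro eq_vecI) auto
    with v show False by simp
  qed
  then have "A \<in> Units (ring_mat TYPE(real) (Suc n) ())"
    by (rule det_non_zero_imp_unit[OF A])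
  then obtain C where C: "C \<in> carrier_mat (Suc n) (Suc n)" "A * C = 1\<^sub>m (Suc n)" "C * A = 1\<^sub>m (Suc n)"
    by (auto simp: Units_def ring_mat_def)
  show ?thesis
  proof (rule that[of "\<lambda>i j. C $$ (i, j)"])
    fix k j assume "k \<le> n" "j \<le> n"
    then have "(A * C) $$ (k, j) = (\<Sum>i = 0..<Suc n. y k i * C $$ (i, j))"
      using A C(1) by (auto simp: scalar_prod_def A_def intro!: sum.cong)
    then show "(\<Sum>i\<le>n. y k i * C $$ (i, j)) = (if k = j then 1 else 0)"
      unfolding sum_eq C(2) using \<open>k \<le> n\<close> \<open>j \<le> n\<close> by simp
  next
    fix i l assume "i \<le> n" "l \<le> n"
    then have "(C * A) $$ (i, l) = (\<Sum>k = 0..<Suc n. C $$ (i, k) * y k l)"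
      using A C(1) by (auto simp: scalar_prod_def A_def intro!: sum.cong)
    then show "(\<Sum>k\<le>n. C $$ (i, k) * y k l) = (if i = l then 1 else 0)"
      unfolding sum_eq C(3) using \<open>i \<le> n\<close> \<open>l \<le> n\<close> by simp
  qed
qed

lemma poly_eq_0_of_many_roots:
  fixes P :: "real poly"
  assumes "degree P \<le> n" "inj_on xi {..n}" "\<And>i. i \<le> n \<Longrightarrow> poly P (xi i) = 0"
  shows "P = 0"
proof (rule ccontr)
  assume "P \<noteq> 0"
  then have fin: "finite {x. poly P x = 0}" by (rule poly_roots_finite)
  have "Suc n = card (xi ` {..n})" using assms(2) by (simp add: card_image)
  also have "\<dots> \<le> card {x. poly P x = 0}" using assms(3) fin by (intro card_mono) auto
  also have "\<dots> \<le> degree P" using \<open>P \<noteq> 0\<close> by (rule card_poly_roots_bound)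
  finally show False using assms(1) by simp
qed

text \<open>The coefficients of the product are, up to sign, those of the product of the \<open>x + xi l\<close>, and no
term of a sum of nonnegative numbers exceeds the sum.\<close>

lemma abs_coeff_prod_linear_le:
  fixes xi :: "'a \<Rightarrow> real"
  assumes "finite L" "\<And>l. l \<in> L \<Longrightarrow> 0 \<le> xi l" "0 \<le> t"
  shows "\<bar>coeff (\<Prod>l\<in>L. [:- xi l, 1:]) j\<bar> * t ^ j \<le> (\<Prod>l\<in>L. xi l + t)"
  using assms(1,2)
proof (induction L arbitrary: j rule: finite_induct)
  case empty
  then show ?case by (cases j) (auto simp: coeff_eq_0)
next
  case (insert a L)
  define Q where "Q = (\<Prod>l\<in>L. [:- xi l, 1:])"
  define M where "M = (\<Prod>l\<in>L. xi l + t)"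
  have IH: "\<bar>coeff Q j\<bar> * t ^ j \<le> M" for j
    using insert by (auto simp: Q_def M_def)
  have a: "0 \<le> xi a" using insert by auto
  have c: "\<bar>coeff ([:- xi a, 1:] * Q) j\<bar> * t ^ j \<le> xi a * M + t * M"
  proof (cases j)
    case 0
    have "xi a * (\<bar>coeff Q 0\<bar> * t ^ 0) \<le> xi a * M" using IH[of 0] a by (rule mult_left_mono)
    moreover have "0 \<le> M" using insert assms(3) by (auto simp: M_def intro!: prod_nonneg)
    ultimately show ?thesis using 0 a assms(3) by (simp add: abs_mult) (smt (verit) mult_nonneg_nonneg)
  next
    case (Suc i)
    have "\<bar>coeff ([:- xi a, 1:] * Q) j\<bar> * t ^ j = \<bar>coeff Q i - xi a * coeff Q j\<bar> * t ^ j"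
      by (simp add: Suc)
    also have "\<dots> \<le> (\<bar>coeff Q i\<bar> + xi a * \<bar>coeff Q j\<bar>) * t ^ j"
      using a assms(3) by (intro mult_right_mono order_trans[OF abs_triangle_ineq4]) (auto simp: abs_mult)
    also have "\<dots> = t * (\<bar>coeff Q i\<bar> * t ^ i) + xi a * (\<bar>coeff Q j\<bar> * t ^ j)"
      by (simp add: Suc algebra_simps)
    also have "\<dots> \<le> t * M + xi a * M"
      using IH[of i] IH[of j] a assms(3) by (intro add_mono mult_left_mono) auto
    finally show ?thesis by simp
  qed
  show ?case using c insert(1,2) by (simp add: Q_def M_def distrib_right)
qed

text \<open>Functionals \<open>\<Lambda>\<^sub>0, \<dots>, \<Lambda>\<^sub>n\<close> on polynomials of degree at most \<open>n\<close>, given by their moments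
\<open>y k i = \<Lambda>\<^sub>i(x\<^sup>k)\<close>, for which a mean value theorem holds: \<open>\<Lambda>\<^sub>i(P) = P(x) / x ^ m i\<close> for some \<open>x\<close> in
\<open>I i\<close>. The sets \<open>I 0, I 1, \<dots>\<close> follow each other from right to left, separated by a factor \<open>2\<close>.
The aim is to write the \<open>j\<close>-th coefficient of \<open>P\<close> as \<open>\<Sum>i. \<beta> i * \<Lambda>\<^sub>i(P)\<close> with control of \<open>\<beta>\<close>.

If all \<open>\<Lambda>\<^sub>i(P)\<close> vanish, then \<open>P\<close> has a root in every \<open>I i\<close>, hence \<open>n + 1\<close> roots, and \<open>P = 0\<close>. So there
are polynomials \<open>P\<^sub>i\<close> dual to the functionals, and \<open>\<beta> i\<close> is the \<open>j\<close>-th coefficient of \<open>P\<^sub>i\<close>. But \<open>P\<^sub>i\<close>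
has roots \<open>xi l\<close> in \<open>I l\<close> for \<open>l \<noteq> i\<close> and is known at some \<open>xi i\<close> in \<open>I i\<close>, so it is a Lagrange polynomial:
\<open>xi i ^ m i\<close> times the product over \<open>l \<noteq> i\<close> of \<open>(x - xi l) / (xi i - xi l)\<close>. The separation
gives \<open>xi l + xi i \<le> 3 * |xi i - xi l|\<close>, which bounds its coefficients.\<close>

lemma moment_dual_basis:
  fixes y :: "nat \<Rightarrow> nat \<Rightarrow> real" and I :: "nat \<Rightarrow> real set" and m :: "nat \<Rightarrow> nat"
  assumes mv: "\<And>i c. i \<le> n \<Longrightarrow> \<exists>x\<in>I i. (\<Sum>k\<le>n. c k * y k i) = (\<Sum>k\<le>n. c k * x ^ k) / x ^ m i"
    and pos: "\<And>i x. i \<le> n \<Longrightarrow> x \<in> I i \<Longrightarrow> 0 < x"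
    and sep: "\<And>l i x z. l < i \<Longrightarrow> i \<le> n \<Longrightarrow> x \<in> I l \<Longrightarrow> z \<in> I i \<Longrightarrow> 2 * z \<le> x"
    and j: "j \<le> n"
  obtains \<beta> where
    "\<And>k. k \<le> n \<Longrightarrow> (\<Sum>i\<le>n. y k i * \<beta> i) = (if k = j then 1 else 0)"
    "\<And>i. i \<le> n \<Longrightarrow> m i = j \<Longrightarrow> \<bar>\<beta> i\<bar> \<le> 3 ^ n"
    "\<And>i t. 0 < i \<Longrightarrow> i \<le> n \<Longrightarrow> Suc (m i) = n \<Longrightarrow> j = n \<Longrightarrow> 0 < t \<Longrightarrow> (\<And>x. x \<in> I 0 \<Longrightarrow> t \<le> x) \<Longrightarrow>
       \<bar>\<beta> i\<bar> \<le> 3 ^ n / t"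
proof -
  define pol where "pol c = (\<Sum>k\<le>n. monom (c k) k)" for c :: "nat \<Rightarrow> real"
  have pol_poly: "poly (pol c) x = (\<Sum>k\<le>n. c k * x ^ k)" for c x
    by (simp add: pol_def poly_sum poly_monom)
  have pol_coeff: "coeff (pol c) k = c k" if "k \<le> n" for c k
    using that by (simp add: pol_def coeff_sum coeff_monom if_distrib sum.delta cong: if_cong)
  have pol_degree: "degree (pol c) \<le> n" for c
    unfolding pol_def by (rule degree_sum_le) (auto intro: order_trans[OF degree_monom_le])
  have diff: "x + z \<le> 3 * \<bar>z - x\<bar>" if "i \<le> n" "l \<le> n" "l \<noteq> i" "x \<in> I l" "z \<in> I i" for i l x z
    using sep[of l i x z] sep[of i l z x] pos[of i z] pos[of l x] that by (cases "l < i") auto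
  have prod_diff: "(\<Prod>l\<in>{..n} - {i}. xi l + xi i) \<le> (\<Prod>l\<in>{..n} - {i}. 3 * \<bar>xi i - xi l\<bar>)"
    if i: "i \<le> n" and xi: "\<And>l. l \<le> n \<Longrightarrow> xi l \<in> I l" for i and xi :: "nat \<Rightarrow> real"
  proof (rule prod_mono, rule conjI)
    fix l assume l: "l \<in> {..n} - {i}"
    then show "0 \<le> xi l + xi i"
      using pos[OF i xi[OF i]] pos[of l "xi l"] xi[of l] by simp
    show "xi l + xi i \<le> 3 * \<bar>xi i - xi l\<bar>"
      using diff[of i l "xi l" "xi i"] i xi l by auto
  qed
  have inj: "inj_on xi {..n}" if "\<And>i. i \<le> n \<Longrightarrow> xi i \<in> I i" for xi
  proof (rule inj_onI)
    fix i l assume il: "i \<in> {..n}" "l \<in> {..n}" "xi i = xi l"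
    show "i = l"
    proof (rule ccontr)
      assume "i \<noteq> l"
      then show False using diff[of i l "xi l" "xi i"] il that[of i] that[of l] pos[of i "xi i"] by auto
    qed
  qed
  have ker: "\<forall>k\<le>n. c k = 0" if c: "\<forall>i\<le>n. (\<Sum>k\<le>n. c k * y k i) = 0" for c
  proof -
    have "\<exists>x\<in>I i. poly (pol c) x = 0" if il: "i \<le> n" for i
    proof -
      obtain x where x: "x \<in> I i" "(\<Sum>k\<le>n. c k * y k i) = (\<Sum>k\<le>n. c k * x ^ k) / x ^ m i"
        using mv[OF il] by blast
      then show ?thesis using c il pos[OF il x(1)] by (auto simp: pol_poly)
    qed
    then obtain xi where xi: "\<And>i. i \<le> n \<Longrightarrow> xi i \<in> I i \<and> poly (pol c) (xi i) = 0" by metis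
    then have "pol c = 0"
      by (intro poly_eq_0_of_many_roots[OF pol_degree, of xi] inj) auto
    then show ?thesis using pol_coeff by (metis coeff_0)
  qed
  obtain B where B1: "\<And>k j. k \<le> n \<Longrightarrow> j \<le> n \<Longrightarrow> (\<Sum>i\<le>n. y k i * B i j) = (if k = j then 1 else 0)"
    and B2: "\<And>i l. i \<le> n \<Longrightarrow> l \<le> n \<Longrightarrow> (\<Sum>k\<le>n. B i k * y k l) = (if i = l then 1 else 0)"
    using square_system_inverse[OF ker] by blast
  \<comment> \<open>Cramer-type formula: comparing \<open>pol (B i)\<close> with the Lagrange polynomial for the nodes
    \<open>xi\<close>, cleared of denominators.\<close>
  have key: "\<exists>xi. (\<forall>l\<le>n. xi l \<in> I l) \<and>
     B i j * (\<Prod>l\<in>{..n} - {i}. xi i - xi l) = xi i ^ m i * coeff (\<Prod>l\<in>{..n} - {i}. [:- xi l, 1:]) j"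
    if i: "i \<le> n" for i
  proof -
    have "\<exists>x\<in>I l. poly (pol (B i)) x = (if l = i then x ^ m i else 0)" if il: "l \<le> n" for l
    proof -
      obtain x where x: "x \<in> I l" "(\<Sum>k\<le>n. B i k * y k l) = (\<Sum>k\<le>n. B i k * x ^ k) / x ^ m l"
        using mv[OF il] by blast
      then show ?thesis using B2[OF i il] pos[OF il x(1)]
        by (intro bexI[OF _ x(1)]) (auto simp: pol_poly field_simps split: if_splits)
    qed
    then obtain xi where xi: "\<And>l. l \<le> n \<Longrightarrow> xi l \<in> I l"
      "\<And>l. l \<le> n \<Longrightarrow> poly (pol (B i)) (xi l) = (if l = i then xi l ^ m i else 0)" by metis
    define Q where "Q = (\<Prod>l\<in>{..n} - {i}. [:- xi l, 1:])"
    define d where "d = (\<Prod>l\<in>{..n} - {i}. xi i - xi l)"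
    have Qi: "poly Q (xi l) = (if l = i then d else 0)" if "l \<le> n" for l
      using that i by (auto simp: Q_def d_def poly_prod intro!: prod.cong prod_zero)
    have "degree Q \<le> n"
    proof -
      have "degree Q \<le> (\<Sum>l\<in>{..n} - {i}. degree [:- xi l, 1:])"
        unfolding Q_def using degree_prod_sum_le[of "{..n} - {i}" "\<lambda>l. [:- xi l, 1:]"] by (simp add: o_def)
      also have "\<dots> = n" using i by simp
      finally show ?thesis .
    qed
    then have "degree (Polynomial.smult d (pol (B i)) - Polynomial.smult (xi i ^ m i) Q) \<le> n"
      by (intro degree_diff_le order_trans[OF degree_smult_le] pol_degree)
    then have "Polynomial.smult d (pol (B i)) - Polynomial.smult (xi i ^ m i) Q = 0"
      by (rule poly_eq_0_of_many_roots[OF _ inj[of xi]]) (auto simp: xi Qi)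
    then have "coeff (Polynomial.smult d (pol (B i)) - Polynomial.smult (xi i ^ m i) Q) j = 0" by simp
    then show ?thesis using xi(1) pol_coeff[OF j]
      by (intro exI[of _ xi]) (auto simp: Q_def d_def mult.commute)
  qed
  show ?thesis
  proof (rule that[of "\<lambda>i. B i j"])
    show "(\<Sum>i\<le>n. y k i * B i j) = (if k = j then 1 else 0)" if "k \<le> n" for k
      using B1[OF that j] .
  next
    fix i assume i: "i \<le> n" "m i = j"
    obtain xi where xi: "\<And>l. l \<le> n \<Longrightarrow> xi l \<in> I l"
      "B i j * (\<Prod>l\<in>{..n} - {i}. xi i - xi l) = xi i ^ m i * coeff (\<Prod>l\<in>{..n} - {i}. [:- xi l, 1:]) j"
      using key[OF i(1)] by blast
    define d where "d = (\<Prod>l\<in>{..n} - {i}. \<bar>xi i - xi l\<bar>)"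
    have dd: "0 < d" unfolding d_def
      using inj[of xi, OF xi(1)] i by (intro prod_pos) (auto simp: inj_on_def)
    have "\<bar>B i j\<bar> * d = \<bar>coeff (\<Prod>l\<in>{..n} - {i}. [:- xi l, 1:]) j\<bar> * xi i ^ j"
      using arg_cong[OF xi(2), of abs] i pos[OF i(1) xi(1)[OF i(1)]]
      by (simp add: abs_mult d_def abs_prod mult.commute)
    also have "\<dots> \<le> (\<Prod>l\<in>{..n} - {i}. xi l + xi i)"
      using pos xi(1) i by (intro abs_coeff_prod_linear_le) (auto intro: less_imp_le)
    also have "\<dots> \<le> (\<Prod>l\<in>{..n} - {i}. 3 * \<bar>xi i - xi l\<bar>)"
      using i xi(1) by (intro prod_diff)
    also have "\<dots> = 3 ^ n * d" using i by (simp add: prod.distrib d_def)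
    finally show "\<bar>B i j\<bar> \<le> 3 ^ n" using dd by simp
  next
    fix i t assume i: "0 < i" "i \<le> n" "Suc (m i) = n" "j = n" "0 < (t::real)"
      and t: "\<And>x. x \<in> I 0 \<Longrightarrow> t \<le> x"
    obtain xi where xi: "\<And>l. l \<le> n \<Longrightarrow> xi l \<in> I l"
      "B i j * (\<Prod>l\<in>{..n} - {i}. xi i - xi l) = xi i ^ m i * coeff (\<Prod>l\<in>{..n} - {i}. [:- xi l, 1:]) j"
      using key[OF i(2)] by blast
    define d where "d = (\<Prod>l\<in>{..n} - {i}. \<bar>xi i - xi l\<bar>)"
    have dd: "0 < d" unfolding d_def
      using inj[of xi, OF xi(1)] i by (intro prod_pos) (auto simp: inj_on_def)
    have xp: "0 < xi l" if "l \<le> n" for l using pos[OF that xi(1)[OF that]] .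
    have "coeff (\<Prod>l\<in>{..n} - {i}. [:- xi l, 1:]) n = 1"
    proof -
      have "degree (\<Prod>l\<in>{..n} - {i}. [:- xi l, 1:]) = n"
        using i by (subst degree_prod_eq_sum_degree) auto
      moreover have "lead_coeff (\<Prod>l\<in>{..n} - {i}. [:- xi l, 1:]) = 1"
        by (simp add: lead_coeff_prod)
      ultimately show ?thesis by simp
    qed
    then have "\<bar>B i j\<bar> * d = xi i ^ m i"
      using arg_cong[OF xi(2), of abs] i xp[OF i(2)] by (simp add: abs_mult d_def abs_prod)
    moreover have "t * xi i ^ m i \<le> 3 ^ n * d"
    proof -
      have mi: "m i = n - Suc 0" using i by simp
      have eq: "{..n} - {i} = insert 0 ({1..n} - {i})" using i by auto
      have "t * xi i ^ m i \<le> (xi 0 + xi i) * (\<Prod>l\<in>{1..n} - {i}. xi l + xi i)"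
      proof (rule mult_mono)
        show "t \<le> xi 0 + xi i" using t[OF xi(1)[of 0]] xp[of i] i by simp
        have "xi i ^ m i = (\<Prod>l\<in>{1..n} - {i}. xi i)" using i by (simp add: mi)
        also have "\<dots> \<le> (\<Prod>l\<in>{1..n} - {i}. xi l + xi i)"
          using xp i by (intro prod_mono) (auto intro: less_imp_le)
        finally show "xi i ^ m i \<le> (\<Prod>l\<in>{1..n} - {i}. xi l + xi i)" .
      qed (use xp[of 0] xp[of i] i in auto)
      also have "\<dots> = (\<Prod>l\<in>{..n} - {i}. xi l + xi i)" unfolding eq by simp
      also have "\<dots> \<le> (\<Prod>l\<in>{..n} - {i}. 3 * \<bar>xi i - xi l\<bar>)"
        using i xi(1) by (intro prod_diff)
      also have "\<dots> = 3 ^ n * d" using i by (simp add: prod.distrib d_def)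
      finally show ?thesis .
    qed
    ultimately have "(t * \<bar>B i j\<bar>) * d \<le> 3 ^ n * d" by (simp add: mult.assoc)
    then have "t * \<bar>B i j\<bar> \<le> 3 ^ n" using dd by simp
    then show "\<bar>B i j\<bar> \<le> 3 ^ n / t" using i by (simp add: pos_le_divide_eq mult.commute)
  qed
qed

section \<open>Hardy operators and the dual weight\<close>

lemma AE_pos: "AE x in lebesgue_on {0<..}. (0::real) < x"
  by (rule AE_I2) (simp add: space_restrict_space)

text \<open>The part of the hypotheses that concerns only \<open>p\<close> and \<open>u\<close>, without the doubling condition.\<close>

locale hardy_weight =
  fixes p :: ennreal and u :: "real \<Rightarrow> ennreal"
  assumes p: "1 < p" and weight_u: "weight u"
    and dual_0_finite: "\<And>r. 0 < r \<Longrightarrow> dual_integral p u 0 r < \<infinity>"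
begin

definition dual_weight :: "real \<Rightarrow> ennreal" where
  "dual_weight x = ennpowr (inverse (u x)) (conj_exp p)"

definition dual_density :: "real \<Rightarrow> real \<Rightarrow> ennreal" where
  "dual_density s x = ennreal (x powr (s * conj_exp p)) * dual_weight x"

lemma u_measurable [measurable]: "u \<in> borel_measurable (lebesgue_on {0<..})"
  using weight_u by (simp add: weight_def)

lemma dual_weight_measurable [measurable]: "dual_weight \<in> borel_measurable (lebesgue_on {0<..})"
  unfolding dual_weight_def[abs_def] by measurable

lemma dual_density_measurable [measurable]: "dual_density s \<in> borel_measurable (lebesgue_on {0<..})"
  unfolding dual_density_def[abs_def]
  by (intro borel_measurable_times_ennreal dual_weight_measurable measurable_compose[OF powr_measurable_pos measurable_ennreal])

lemma dual_integral_eq_primitive: "dual_integral p u s = primitive (dual_density s)"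
  by (simp add: fun_eq_iff dual_integral_def primitive_def dual_density_def dual_weight_def)

text \<open>Where \<open>u\<close> vanishes the integrand of the dual integral is infinite, so finiteness of the dual
integral forces \<open>u > 0\<close> almost everywhere.\<close>

lemma AE_weight_pos_finite: "AE x in lebesgue_on {0<..}. 0 < u x \<and> u x < top"
proof -
  have "AE x in lebesgue. x \<in> {0<..<real (Suc k)} \<longrightarrow> u x \<noteq> 0" for k
  proof -
    have m: "dual_density 0 \<in> borel_measurable (lebesgue_on {0<..<real (Suc k)})"
      by (rule borel_measurable_lebesgue_on_mono[OF _ dual_density_measurable]) auto
    have "AE x in lebesgue_on {0<..<real (Suc k)}. dual_density 0 x \<noteq> \<infinity>"
      using dual_0_finite[of "real (Suc k)"]
      by (intro nn_integral_PInf_AE[OF m]) (auto simp: dual_integral_eq_primitive primitive_def)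
    then have "AE x in lebesgue. x \<in> {0<..<real (Suc k)} \<longrightarrow> dual_density 0 x \<noteq> \<infinity>"
      by (simp add: AE_restrict_space_iff)
    then show ?thesis
    proof eventually_elim
      case (elim x)
      show ?case
      proof (intro impI notI)
        assume x: "x \<in> {0<..<real (Suc k)}" "u x = 0"
        then have "dual_density 0 x = top" by (simp add: dual_density_def dual_weight_def)
        with elim x show False by simp
      qed
    qed
  qed
  then have "AE x in lebesgue. \<forall>k. x \<in> {0<..<real (Suc k)} \<longrightarrow> u x \<noteq> 0"
    by (subst AE_all_countable) blast
  then have "AE x in lebesgue. x \<in> {0<..} \<longrightarrow> u x \<noteq> 0"
  proof eventually_elim
    case (elim x)
    obtain k where "x < real k" using reals_Archimedean2 by blast
    then have "x < real (Suc k)" by simp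
    then show ?case using elim[rule_format, of k] by auto
  qed
  then have "AE x in lebesgue_on {0<..}. u x \<noteq> 0"
    by (simp add: AE_restrict_space_iff)
  moreover have "AE x in lebesgue_on {0<..}. u x < \<infinity>" using weight_u by (simp add: weight_def)
  ultimately show ?thesis by eventually_elim (auto simp: zero_less_iff_neq_zero)
qed

lemma AE_dual_weight: "AE x in lebesgue_on {0<..}. 0 < dual_weight x \<and> dual_weight x < top"
  using AE_weight_pos_finite
proof eventually_elim
  case (elim x)
  then obtain c where "u x = ennreal c" "0 < c" by (cases "u x") auto
  then show ?case by (simp add: dual_weight_def inverse_ennreal ennpowr_ennreal)
qed

lemma primitive_dual_density_finite: "0 \<le> s \<Longrightarrow> 0 < r \<Longrightarrow> primitive (dual_density s) r < top"
proof -
  assume s: "0 \<le> s" and r: "0 < r"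
  have "primitive (dual_density s) r \<le> (\<integral>\<^sup>+x. ennreal (r powr (s * conj_exp p)) * dual_density 0 x \<partial>lebesgue_on {0<..<r})"
    unfolding primitive_def
  proof (rule nn_integral_mono)
    fix x assume "x \<in> space (lebesgue_on {0<..<r})"
    then have x: "0 < x" "x < r" by (auto simp: space_restrict_space)
    have "x powr (s * conj_exp p) \<le> r powr (s * conj_exp p)"
      using x s conj_exp_pos[OF p] by (intro powr_mono2) auto
    then show "dual_density s x \<le> ennreal (r powr (s * conj_exp p)) * dual_density 0 x"
      using x by (simp add: dual_density_def mult_right_mono ennreal_leI)
  qed
  also have "\<dots> = ennreal (r powr (s * conj_exp p)) * primitive (dual_density 0) r"
    unfolding primitive_def
    by (rule nn_integral_cmult) (rule borel_measurable_lebesgue_on_mono[OF _ dual_density_measurable], auto)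
  also have "\<dots> < top"
    using dual_0_finite[OF r] by (simp add: ennreal_mult_less_top dual_integral_eq_primitive)
  finally show ?thesis .
qed

lemma primitive_dual_density_pos: assumes "0 < r" shows "0 < primitive (dual_density s) r"
proof -
  have sub: "{0<..<r} \<subseteq> {0<..}" by auto
  have m: "dual_density s \<in> borel_measurable (lebesgue_on {0<..<r})"
    by (rule borel_measurable_lebesgue_on_mono[OF sub dual_density_measurable])
  have "AE x in lebesgue_on {0<..<r}. 0 < dual_weight x"
    using AE_lebesgue_on_mono[OF sub _ _ AE_dual_weight] by auto
  moreover have "AE x in lebesgue_on {0<..<r}. 0 < x"
    using AE_lebesgue_on_mono[OF sub _ _ AE_pos] by auto
  ultimately have pos: "AE x in lebesgue_on {0<..<r}. dual_density s x \<noteq> 0"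
    by eventually_elim (auto simp: dual_density_def)
  have "primitive (dual_density s) r \<noteq> 0"
  proof
    assume "primitive (dual_density s) r = 0"
    then have "AE x in lebesgue_on {0<..<r}. dual_density s x = 0"
      using nn_integral_0_iff_AE[OF m] by (simp add: primitive_def)
    with pos have "AE x in lebesgue_on {0<..<r}. False" by eventually_elim simp
    then have "ae_filter (lebesgue_on {0<..<r}) = bot" by (simp only: trivial_limit_def)
    then have "emeasure (lebesgue_on {0<..<r}) (space (lebesgue_on {0<..<r})) = 0"
      by (simp only: ae_filter_eq_bot_iff)
    then show False using assms by (simp add: emeasure_restrict_space space_restrict_space)
  qed
  then show ?thesis by (simp add: zero_less_iff_neq_zero)
qed

text \<open>Almost everywhere \<open>t\<^sup>k |f(t)|\<close> is the product of \<open>u(t) |f(t)|\<close> and this factor, and the \<open>p'\<close>-th power of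
the factor is the integrand of the \<open>k\<close>-th dual integral.\<close>

definition dual_factor :: "nat \<Rightarrow> real \<Rightarrow> ennreal" where
  "dual_factor k x = ennreal (x ^ k) * inverse (u x)"

lemma dual_factor_measurable [measurable]: "dual_factor k \<in> borel_measurable (lebesgue_on {0<..})"
  unfolding dual_factor_def[abs_def] by measurable

lemma primitive_dual_factor:
  "primitive (\<lambda>x. ennpowr (dual_factor k x) (conj_exp p)) r = dual_integral p u (real k) r"
  unfolding dual_integral_eq_primitive
  by (rule primitive_cong_pos)
    (simp add: dual_factor_def dual_density_def dual_weight_def ennpowr_mult ennpowr_ennreal powr_powr flip: powr_realpow)

lemma weighted_spaceD:
  assumes "f \<in> weighted_space p u"
  shows "f \<in> borel_measurable (lebesgue_on {0<..})"
    "(\<lambda>x. u x * ennreal (cmod (f x))) \<in> borel_measurable (lebesgue_on {0<..})"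
    "lp_norm p {0<..} (\<lambda>x. u x * ennreal (cmod (f x))) < top"
    "lp_norm p {0<..} (\<lambda>x. u x * ennreal (cmod (f x))) = weighted_norm p u f"
proof -
  show [measurable]: "f \<in> borel_measurable (lebesgue_on {0<..})"
    using assms by (simp add: weighted_space_def)
  show "(\<lambda>x. u x * ennreal (cmod (f x))) \<in> borel_measurable (lebesgue_on {0<..})" by measurable
qed (use assms in \<open>simp_all add: weighted_space_def weighted_norm_def\<close>)

abbreviation majorant :: "nat \<Rightarrow> (real \<Rightarrow> complex) \<Rightarrow> real \<Rightarrow> ennreal" where
  "majorant k f \<equiv> primitive (\<lambda>t. (u t * ennreal (cmod (f t))) * dual_factor k t)"

lemma nn_integral_eq_majorant:
  "(\<integral>\<^sup>+t. ennreal (cmod (complex_of_real t ^ k * f t)) \<partial>lebesgue_on {0<..<x}) = majorant k f x"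
  unfolding primitive_def
proof (rule nn_integral_cong_AE)
  have sub: "{0<..<x} \<subseteq> {0<..}" by auto
  have "AE t in lebesgue_on {0<..<x}. 0 < u t \<and> u t < top"
    by (rule AE_lebesgue_on_mono[OF sub _ _ AE_weight_pos_finite]) auto
  moreover have "AE t in lebesgue_on {0<..<x}. 0 < t"
    by (rule AE_lebesgue_on_mono[OF sub _ _ AE_pos]) auto
  ultimately show "AE t in lebesgue_on {0<..<x}. ennreal (cmod (complex_of_real t ^ k * f t)) =
      (u t * ennreal (cmod (f t))) * dual_factor k t"
  proof eventually_elim
    case (elim t)
    have "u t * inverse (u t) = 1" using elim
      by (cases "u t") (auto simp: inverse_ennreal ennreal_mult[symmetric])
    have "(u t * ennreal (cmod (f t))) * dual_factor k t =
      (u t * inverse (u t)) * (ennreal (t ^ k) * ennreal (cmod (f t)))"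
      unfolding dual_factor_def by (simp only: ac_simps)
    also have "\<dots> = ennreal (cmod (complex_of_real t ^ k * f t))"
      using elim \<open>u t * inverse (u t) = 1\<close> by (simp add: norm_mult norm_power ennreal_mult[symmetric])
    finally show ?case by simp
  qed
qed

lemma majorant_finite:
  assumes "f \<in> weighted_space p u" "0 < x"
  shows "majorant k f x < top"
proof -
  have "majorant k f x \<le> lp_norm p {0<..} (\<lambda>x. u x * ennreal (cmod (f x))) *
      ennpowr (primitive (\<lambda>x. ennpowr (dual_factor k x) (conj_exp p)) x) (1 / conj_exp p)"
    by (rule primitive_Hoelder[OF p weighted_spaceD(2)[OF assms(1)] dual_factor_measurable])
  also have "\<dots> < top"
    unfolding primitive_dual_factor dual_integral_eq_primitive
    using weighted_spaceD(3)[OF assms(1)] primitive_dual_density_finite[of "real k" x] assms(2)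
    by (simp add: ennreal_mult_less_top)
  finally show ?thesis .
qed

lemma hardy_integrable:
  assumes "f \<in> weighted_space p u" "0 < x"
  shows "integrable (lebesgue_on {0<..<x}) (\<lambda>t. complex_of_real t ^ k * f t)"
proof (rule integrableI_bounded)
  have [measurable]: "f \<in> borel_measurable (lebesgue_on {0<..})"
    using weighted_spaceD[OF assms(1)] by simp
  have "(\<lambda>t. complex_of_real t ^ k * f t) \<in> borel_measurable (lebesgue_on {0<..})"
    by measurable
  then show "(\<lambda>t. complex_of_real t ^ k * f t) \<in> borel_measurable (lebesgue_on {0<..<x})"
    by (rule measurable_restrict_mono) auto
  show "(\<integral>\<^sup>+t. ennreal (cmod (complex_of_real t ^ k * f t)) \<partial>lebesgue_on {0<..<x}) < \<infinity>"
    using majorant_finite[OF assms] by (simp add: nn_integral_eq_majorant)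
qed

lemma hardy_measurable:
  assumes "f \<in> weighted_space p u"
  shows "hardy k f \<in> borel_measurable (lebesgue_on {0<..})"
proof -
  have "continuous_on {0..} (hardy k f)"
    using continuous_on_integral_upto[OF hardy_integrable[OF assms]] by (simp add: hardy_def[abs_def])
  then have "continuous_on {0<..} (hardy k f)" by (rule continuous_on_subset) auto
  then show ?thesis by (rule continuous_imp_measurable_on_sets_lebesgue) simp
qed

lemma norm_hardy_le:
  assumes "f \<in> weighted_space p u" "0 < x"
  shows "ennreal (cmod (hardy k f x)) \<le> majorant k f x"
  unfolding hardy_def nn_integral_eq_majorant[symmetric]
  by (rule integral_norm_bound_ennreal) (rule hardy_integrable[OF assms])

lemma hardy_component_bound:
  assumes q: "p \<le> q" and v[measurable]: "v \<in> borel_measurable (lebesgue_on {0<..})"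
    and a[measurable]: "a k \<in> borel_measurable (lebesgue_on {0<..})"
    and f: "f \<in> weighted_space p u"
  shows "weighted_norm q v (\<lambda>x. a k x * hardy k f x) \<le> 4 * S_value a p q u v k * weighted_norm p u f"
proof -
  note [measurable] = hardy_measurable[OF f]
  have q1: "1 < q" using p q by simp
  have "weighted_norm q v (\<lambda>x. a k x * hardy k f x) \<le>
     lp_norm q {0<..} (\<lambda>x. (ennreal (cmod (a k x)) * v x) * majorant k f x)"
    unfolding weighted_norm_def
  proof (rule lp_norm_mono_AE[OF q1])
    show "(\<lambda>x. v x * ennreal (cmod (a k x * hardy k f x))) \<in> borel_measurable (lebesgue_on {0<..})"
      by measurable
    show "AE x in lebesgue_on {0<..}. v x * ennreal (cmod (a k x * hardy k f x))
        \<le> ennreal (cmod (a k x)) * v x * majorant k f x"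
      using AE_pos
    proof eventually_elim
      case (elim x)
      have "v x * ennreal (cmod (a k x * hardy k f x)) =
          (ennreal (cmod (a k x)) * v x) * ennreal (cmod (hardy k f x))"
        by (simp add: norm_mult ennreal_mult ac_simps)
      also have "\<dots> \<le> (ennreal (cmod (a k x)) * v x) * majorant k f x"
        using norm_hardy_le[OF f elim] by (rule mult_left_mono) simp
      finally show ?case .
    qed
  qed
  also have "\<dots> \<le> 4 * S_value a p q u v k * lp_norm p {0<..} (\<lambda>x. u x * ennreal (cmod (f x)))"
  proof (rule weighted_hardy_inequality[OF p q])
    show "primitive (\<lambda>x. ennpowr (dual_factor k x) (conj_exp p)) r < top" if "0 < r" for r
      using primitive_dual_density_finite[of "real k" r] that
      by (simp add: primitive_dual_factor dual_integral_eq_primitive)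
    show "lp_norm q {r<..} (\<lambda>x. ennreal (cmod (a k x)) * v x) *
        ennpowr (primitive (\<lambda>x. ennpowr (dual_factor k x) (conj_exp p)) r) (1 / conj_exp p)
        \<le> S_value a p q u v k" if "0 < r" for r
      unfolding S_value_def primitive_dual_factor by (rule SUP_upper) (use that in simp)
  qed (use weighted_spaceD[OF f] in \<open>simp_all\<close>)
  finally show ?thesis using weighted_spaceD[OF f] by simp
qed

text \<open>Minkowski's inequality. As its constant is \<open>1\<close>, no dependence on \<open>n\<close> enters here, which keeps
\<open>K1\<close> in the theorem independent of \<open>n\<close>.\<close>

lemma sum_bounded_by_components:
  assumes q: "p \<le> q" and v[measurable]: "v \<in> borel_measurable (lebesgue_on {0<..})"
    and a: "\<And>k. k \<le> n \<Longrightarrow> a k \<in> borel_measurable (lebesgue_on {0<..})"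
    and c: "\<And>k f. k \<le> n \<Longrightarrow> f \<in> weighted_space p u \<Longrightarrow>
      weighted_norm q v (\<lambda>x. a k x * hardy k f x) \<le> c k * weighted_norm p u f"
  shows "sum_bounded_by n a p q u v (\<Sum>k\<le>n. c k)"
  unfolding sum_bounded_by_def
proof
  fix f assume f: "f \<in> weighted_space p u"
  note [measurable] = hardy_measurable[OF f]
  have q1: "1 < q" using p q by simp
  have m: "(\<lambda>x. a k x * hardy k f x) \<in> borel_measurable (lebesgue_on {0<..})" if "k \<le> n" for k
    using a[OF that] by measurable
  have ms: "(\<lambda>x. \<Sum>k\<le>n. a k x * hardy k f x) \<in> borel_measurable (lebesgue_on {0<..})"
    by (rule borel_measurable_sum) (use m in auto)
  have mv: "(\<lambda>x. v x * ennreal (cmod (g x))) \<in> borel_measurable (lebesgue_on {0<..})"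
    if "g \<in> borel_measurable (lebesgue_on {0<..})" for g
    using that by measurable
  have "weighted_norm q v (\<lambda>x. \<Sum>k\<le>n. a k x * hardy k f x)
      \<le> lp_norm q {0<..} (\<lambda>x. \<Sum>k\<le>n. v x * ennreal (cmod (a k x * hardy k f x)))"
    unfolding weighted_norm_def
  proof (rule lp_norm_mono_AE[OF q1 mv[OF ms]], rule AE_I2)
    fix x
    have "v x * ennreal (cmod (\<Sum>k\<le>n. a k x * hardy k f x)) \<le> v x * ennreal (\<Sum>k\<le>n. cmod (a k x * hardy k f x))"
      by (intro mult_left_mono ennreal_leI norm_sum) simp
    then show "v x * ennreal (cmod (\<Sum>k\<le>n. a k x * hardy k f x)) \<le> (\<Sum>k\<le>n. v x * ennreal (cmod (a k x * hardy k f x)))"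
      by (simp add: sum_distrib_left flip: sum_ennreal)
  qed
  also have "\<dots> \<le> (\<Sum>k\<le>n. lp_norm q {0<..} (\<lambda>x. v x * ennreal (cmod (a k x * hardy k f x))))"
    by (rule lp_norm_sum_le[OF q1]) (use mv m in auto)
  also have "\<dots> \<le> (\<Sum>k\<le>n. c k * weighted_norm p u f)"
    using c[OF _ f] by (intro sum_mono) (auto simp: weighted_norm_def)
  finally show "weighted_norm q v (\<lambda>x. \<Sum>k\<le>n. a k x * hardy k f x) \<le> (\<Sum>k\<le>n. c k) * weighted_norm p u f"
    by (simp add: sum_distrib_right)
qed

end

section \<open>Intervals of comparable mass\<close>

text \<open>If \<open>g\<close> never took its mean value \<open>c\<close>, then \<open>g - c\<close> would have a fixed sign on the interval, so that
\<open>(g - c) * rho\<close>, whose integral is \<open>0\<close>, would vanish almost everywhere, and \<open>rho\<close> with it.\<close>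

lemma weighted_mean_value:
  fixes g rho :: "real \<Rightarrow> real"
  assumes ab: "0 < a" "a < b" and g: "continuous_on {0<..} g"
    and rho: "integrable (lebesgue_on {a..<b}) rho" "\<And>x. 0 \<le> rho x"
    and one: "(LINT x|lebesgue_on {a..<b}. rho x) = 1"
    and int: "integrable (lebesgue_on {a..<b}) (\<lambda>x. g x * rho x)"
  shows "\<exists>x\<in>{a..<b}. (LINT x|lebesgue_on {a..<b}. g x * rho x) = g x"
proof (rule ccontr)
  define c where "c = (LINT x|lebesgue_on {a..<b}. g x * rho x)"
  assume "\<not> ?thesis"
  then have ne: "g x \<noteq> c" if "x \<in> {a..<b}" for x
    using that unfolding c_def by metis
  have zero: "(LINT x|lebesgue_on {a..<b}. (g x - c) * rho x) = 0"
    and int2: "integrable (lebesgue_on {a..<b}) (\<lambda>x. (g x - c) * rho x)"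
    using int rho one by (auto simp: left_diff_distrib c_def)
  have "{a..<b} \<subseteq> {0<..}" using ab by auto
  then have cont: "continuous_on {a..<b} g" using g by (rule continuous_on_subset[rotated])
  have sign: "(\<forall>x\<in>{a..<b}. c < g x) \<or> (\<forall>x\<in>{a..<b}. g x < c)"
  proof (rule ccontr)
    assume "\<not> ?thesis"
    then obtain x z where xz: "x \<in> {a..<b}" "g x < c" "z \<in> {a..<b}" "c < g z"
      using ne by (metis linorder_neqE_linordered_idom)
    have "connected (g ` {a..<b})" by (intro connected_continuous_image cont) simp
    then have "c \<in> g ` {a..<b}"
      using xz connected_contains_Icc[of "g ` {a..<b}" "g x" "g z"] by fastforce
    then show False using ne by blast
  qed
  have "AE x in lebesgue_on {a..<b}. (g x - c) * rho x = 0"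
    using sign
  proof
    assume s: "\<forall>x\<in>{a..<b}. c < g x"
    have nn: "AE x in lebesgue_on {a..<b}. 0 \<le> (g x - c) * rho x"
      by (rule AE_I2) (use s rho(2) in \<open>simp add: space_restrict_space less_imp_le\<close>)
    show ?thesis using integral_nonneg_eq_0_iff_AE[OF int2 nn] zero by simp
  next
    assume s: "\<forall>x\<in>{a..<b}. g x < c"
    have nn: "AE x in lebesgue_on {a..<b}. 0 \<le> - ((g x - c) * rho x)"
      by (rule AE_I2) (use s rho(2) in \<open>simp add: space_restrict_space mult_le_0_iff less_imp_le\<close>)
    have "integrable (lebesgue_on {a..<b}) (\<lambda>x. - ((g x - c) * rho x))" using int2 by simp
    from integral_nonneg_eq_0_iff_AE[OF this nn] zero show ?thesis by simp
  qed
  moreover have "AE x in lebesgue_on {a..<b}. x \<in> {a..<b}"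
    by (rule AE_I2) (simp add: space_restrict_space)
  ultimately have "AE x in lebesgue_on {a..<b}. rho x = 0"
    by eventually_elim (use ne in auto)
  then have "(LINT x|lebesgue_on {a..<b}. rho x) = 0" by (rule integral_eq_zero_AE)
  then show False using one by simp
qed

context hardy_weight
begin

definition real_dual_weight :: "real \<Rightarrow> real" where
  "real_dual_weight x = enn2real (dual_weight x)"

lemma real_dual_weight_measurable: "real_dual_weight \<in> borel_measurable (lebesgue_on {0<..})"
  unfolding real_dual_weight_def[abs_def] by measurable

lemma real_dual_weight_nonneg: "0 \<le> real_dual_weight x" by (simp add: real_dual_weight_def)

lemma AE_real_dual_weight: "AE x in lebesgue_on {0<..}. ennreal (real_dual_weight x) = dual_weight x"
  using AE_dual_weight by eventually_elim (auto simp: real_dual_weight_def)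

lemma primitive_dual_density_halving:
  assumes "0 \<le> s" "0 < r"
  obtains t where "0 < t" "2 * t < r" "primitive (dual_density s) r = 2 * primitive (dual_density s) (2 * t)"
    "(\<integral>\<^sup>+x. dual_density s x \<partial>lebesgue_on {2 * t..<r}) = primitive (dual_density s) (2 * t)"
proof -
  obtain y where y: "primitive (dual_density s) r = ennreal y" "0 < y"
    using primitive_dual_density_finite[OF assms] primitive_dual_density_pos[OF assms(2), of s]
    by (cases "primitive (dual_density s) r") auto
  have "ennreal (y / 2) < primitive (dual_density s) r"
    using y by (simp add: ennreal_less_iff)
  then obtain z where z: "0 < z" "z < r" "primitive (dual_density s) z = ennreal (y / 2)"
    using primitive_IVT[OF dual_density_measurable primitive_dual_density_finite[OF assms(1)] assms(2), of "y / 2"] y(2)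
    by auto
  have "ennreal (y / 2) + (\<integral>\<^sup>+x. dual_density s x \<partial>lebesgue_on {z..<r}) = ennreal y"
    using primitive_split[OF dual_density_measurable z(1), of r s] z y by simp
  then have "(\<integral>\<^sup>+x. dual_density s x \<partial>lebesgue_on {z..<r}) = ennreal y - ennreal (y / 2)"
    by (metis ennreal_add_diff_cancel_left ennreal_neq_top)
  also have "\<dots> = ennreal (y / 2)" using y by (simp add: ennreal_minus)
  finally have I: "(\<integral>\<^sup>+x. dual_density s x \<partial>lebesgue_on {z..<r}) = ennreal (y / 2)" .
  have two: "2 * ennreal (y / 2) = ennreal y"
    using ennreal_mult[of 2 "y / 2"] y by simp
  show ?thesis
    by (rule that[of "z / 2"]) (use z I y two in auto)
qed

text \<open>Doubling is inherited by smaller powers: passing from exponent \<open>s\<close> to \<open>t \<le> s\<close> multiplies the density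
by a decreasing power of \<open>x\<close>, which favours \<open>(0, r)\<close> over \<open>[r, 2 * r)\<close>. It is not inherited by
larger powers.\<close>

lemma doubling_transfer:
  assumes D: "\<And>r. 0 < r \<Longrightarrow> primitive (dual_density s) (2 * r) \<le> ennreal D * primitive (dual_density s) r"
    and t: "t \<le> s" and r: "0 < r"
  shows "primitive (dual_density t) (2 * r) \<le> (1 + ennreal D) * primitive (dual_density t) r"
proof -
  define e where "e = (s - t) * conj_exp p"
  have e: "0 \<le> e" using t conj_exp_pos[OF p] by (simp add: e_def)
  have dens_eq: "dual_density t x = ennreal (x powr - e) * dual_density s x" if "0 < x" for x
  proof -
    have "x powr (t * conj_exp p) = x powr - e * x powr (s * conj_exp p)"
      by (simp add: e_def algebra_simps flip: powr_add)
    then show ?thesis by (simp add: dual_density_def ennreal_mult mult.assoc)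
  qed
  have m: "dual_density s \<in> borel_measurable (lebesgue_on A)" if "A \<subseteq> {0<..}" for A
    by (rule borel_measurable_lebesgue_on_mono[OF that dual_density_measurable])
  have sub: "{0<..<r} \<subseteq> {0<..}" "{r..<2*r} \<subseteq> {0<..}" using r by auto
  have "(\<integral>\<^sup>+x. dual_density t x \<partial>lebesgue_on {r..<2*r}) \<le> (\<integral>\<^sup>+x. ennreal (r powr - e) * dual_density s x \<partial>lebesgue_on {r..<2*r})"
  proof (rule nn_integral_mono)
    fix x assume "x \<in> space (lebesgue_on {r..<2*r})"
    then have x: "r \<le> x" "0 < x" using r by (auto simp: space_restrict_space)
    have "x powr - e \<le> r powr - e" using x r e by (intro powr_mono2') auto
    then show "dual_density t x \<le> ennreal (r powr - e) * dual_density s x"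
      unfolding dens_eq[OF x(2)] by (intro mult_right_mono ennreal_leI) auto
  qed
  also have "\<dots> = ennreal (r powr - e) * (\<integral>\<^sup>+x. dual_density s x \<partial>lebesgue_on {r..<2*r})"
    by (rule nn_integral_cmult[OF m[OF sub(2)]])
  also have "\<dots> \<le> ennreal (r powr - e) * primitive (dual_density s) (2 * r)"
    unfolding primitive_def using r by (intro mult_left_mono nn_integral_lebesgue_on_mono) auto
  also have "\<dots> \<le> ennreal (r powr - e) * (ennreal D * primitive (dual_density s) r)"
    using D[OF r] by (rule mult_left_mono) simp
  also have "\<dots> = ennreal D * (\<integral>\<^sup>+x. ennreal (r powr - e) * dual_density s x \<partial>lebesgue_on {0<..<r})"
    unfolding primitive_def nn_integral_cmult[OF m[OF sub(1)]] by (simp only: ac_simps)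
  also have "\<dots> \<le> ennreal D * primitive (dual_density t) r"
    unfolding primitive_def
  proof (intro mult_left_mono nn_integral_mono)
    fix x assume "x \<in> space (lebesgue_on {0<..<r})"
    then have x: "x < r" "0 < x" by (auto simp: space_restrict_space)
    have "r powr - e \<le> x powr - e" using x r e by (intro powr_mono2') auto
    then show "ennreal (r powr - e) * dual_density s x \<le> dual_density t x"
      unfolding dens_eq[OF x(2)] by (intro mult_right_mono ennreal_leI) auto
  qed simp
  finally have "(\<integral>\<^sup>+x. dual_density t x \<partial>lebesgue_on {r..<2*r}) \<le> ennreal D * primitive (dual_density t) r" .
  then show ?thesis
    using primitive_split[OF dual_density_measurable r, of "2 * r" t] r by (simp add: distrib_right add_left_mono)
qed

lemma primitive_dual_density_le:
  assumes "t \<le> s" "0 < r"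
  shows "primitive (dual_density s) r \<le> ennreal (r powr ((s - t) * conj_exp p)) * primitive (dual_density t) r"
proof -
  define e where "e = (s - t) * conj_exp p"
  have e: "0 \<le> e" using assms conj_exp_pos[OF p] by (simp add: e_def)
  have m: "dual_density t \<in> borel_measurable (lebesgue_on {0<..<r})"
    by (rule borel_measurable_lebesgue_on_mono[OF _ dual_density_measurable]) auto
  have "primitive (dual_density s) r \<le> (\<integral>\<^sup>+x. ennreal (r powr e) * dual_density t x \<partial>lebesgue_on {0<..<r})"
    unfolding primitive_def
  proof (rule nn_integral_mono)
    fix x assume "x \<in> space (lebesgue_on {0<..<r})"
    then have x: "x < r" "0 < x" by (auto simp: space_restrict_space)
    have "x powr (s * conj_exp p) = x powr e * x powr (t * conj_exp p)"
      by (simp add: e_def algebra_simps flip: powr_add)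
    moreover have "x powr e \<le> r powr e" using x e by (intro powr_mono2) auto
    ultimately show "dual_density s x \<le> ennreal (r powr e) * dual_density t x"
      by (simp add: dual_density_def ennreal_mult mult.assoc mult_right_mono ennreal_leI)
  qed
  also have "\<dots> = ennreal (r powr e) * primitive (dual_density t) r"
    unfolding primitive_def by (rule nn_integral_cmult[OF m])
  finally show ?thesis by (simp add: e_def)
qed

text \<open>From each \<open>z i\<close> one descends to the point that halves the mass of \<open>(0, z i)\<close> and then by a further
factor \<open>2\<close>. Thus each interval \<open>[2 * z (Suc i), z i)\<close> carries half of the mass to the left of \<open>z i\<close>, and
consecutive intervals are separated by a factor \<open>2\<close>. The density may change from step to step.\<close>

lemma halving_points:
  fixes h :: "nat \<Rightarrow> real"
  assumes h: "\<And>i. 0 \<le> h i" and r: "0 < r"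
  obtains z :: "nat \<Rightarrow> real" where "z 0 = r" "\<And>i. 0 < z i" "\<And>i. 2 * z (Suc i) < z i"
    "\<And>i. primitive (dual_density (h i)) (z i) = 2 * primitive (dual_density (h i)) (2 * z (Suc i))"
    "\<And>i. (\<integral>\<^sup>+x. dual_density (h i) x \<partial>lebesgue_on {2 * z (Suc i)..<z i}) = primitive (dual_density (h i)) (2 * z (Suc i))"
proof -
  define N where "N i x t \<longleftrightarrow> 0 < t \<and> 2 * t < x \<and> primitive (dual_density (h i)) x = 2 * primitive (dual_density (h i)) (2 * t) \<and>
    (\<integral>\<^sup>+x. dual_density (h i) x \<partial>lebesgue_on {2 * t..<x}) = primitive (dual_density (h i)) (2 * t)" for i x t
  define z where "z = rec_nat r (\<lambda>i x. SOME t. N i x t)"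
  have ex: "\<exists>t. N i x t" if "0 < x" for i x
    using primitive_dual_density_halving[OF h[of i] that] unfolding N_def by metis
  have z0: "z 0 = r" and zS: "z (Suc i) = (SOME t. N i (z i) t)" for i
    by (simp_all add: z_def)
  have pos: "0 < z i" for i
  proof (induction i)
    case (Suc i)
    then show ?case using someI_ex[OF ex[of "z i" i]] by (simp add: zS N_def)
  qed (simp add: z0 r)
  have "N i (z i) (z (Suc i))" for i
    unfolding zS by (rule someI_ex) (rule ex[OF pos])
  then show ?thesis using that[of z] z0 pos by (auto simp: N_def)
qed

end

section \<open>Extremal bumps\<close>

context hardy_weight
begin

text \<open>The function \<open>phi = x\<^bsup>m (p' - 1)\<^esup> u\<^bsup>-p'\<^esup> / W\<close> on \<open>[a, b)\<close> is extremal in Hoelder's inequality for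
the pairing with \<open>x\<^sup>m\<close>: that pairing is \<open>1\<close>, and its norm is \<open>W powr (- 1 / p')\<close>. Since
\<open>rho = x\<^sup>m phi\<close> is a probability density, integrating a polynomial \<open>P\<close> against \<open>phi\<close> amounts to
averaging \<open>P / x\<^sup>m\<close>, which yields the mean value property needed for interpolation.\<close>

lemma bump:
  assumes ab: "0 < a" "a < b" and W: "(\<integral>\<^sup>+x. dual_density (real m) x \<partial>lebesgue_on {a..<b}) = ennreal W" "0 < W"
  obtains phi :: "real \<Rightarrow> real" and y :: "nat \<Rightarrow> real" where
    "phi \<in> borel_measurable (lebesgue_on {0<..})"
    "\<And>A k. {a..<b} \<subseteq> A \<Longrightarrow> A \<in> sets lebesgue \<Longrightarrow>
       has_bochner_integral (lebesgue_on A) (\<lambda>x. x ^ k * phi x) (y k)"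
    "\<And>n c. \<exists>x\<in>{a..<b}. (\<Sum>k\<le>n. c k * y k) = (\<Sum>k\<le>n. c k * x ^ k) / x ^ m"
    "lp_norm p {0<..} (\<lambda>x. u x * ennreal \<bar>phi x\<bar>) * ennpowr (ennreal W) (1 / conj_exp p) \<le> 1"
proof -
  define rho where "rho x = x powr (real m * conj_exp p) * real_dual_weight x / W" for x
  define phi where "phi x = (if x \<in> {a..<b} then rho x / x ^ m else 0)" for x
  define y where "y k = (LINT x|lebesgue_on {a..<b}. x ^ k / x ^ m * rho x)" for k
  have sub: "{a..<b} \<subseteq> {0<..}" using ab by auto
  have in_ab: "AE x in lebesgue_on {a..<b}. x \<in> {a..<b}"
    by (rule AE_I2) (simp add: space_restrict_space)
  have rho_m0: "rho \<in> borel_measurable (lebesgue_on {0<..})"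
    unfolding rho_def[abs_def]
    by (intro borel_measurable_divide borel_measurable_times powr_measurable_pos real_dual_weight_measurable borel_measurable_const)
  then have rho_m: "rho \<in> borel_measurable (lebesgue_on {a..<b})"
    by (rule measurable_restrict_mono[OF _ sub])
  have pow_m: "(\<lambda>x. x ^ k / x ^ m) \<in> borel_measurable (lebesgue_on {a..<b})" for k
    by (rule continuous_imp_measurable_on_sets_lebesgue) (use ab in \<open>auto intro!: continuous_intros\<close>)
  have rho_nonneg: "0 \<le> rho x" for x using W(2) real_dual_weight_nonneg by (simp add: rho_def)
  have arw: "AE x in lebesgue_on {a..<b}. ennreal (real_dual_weight x) = dual_weight x"
    by (rule AE_lebesgue_on_mono[OF sub _ _ AE_real_dual_weight]) auto
  have dens_rho: "AE x in lebesgue_on {a..<b}. dual_density (real m) x = ennreal W * ennreal (rho x)"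
    using arw
  proof eventually_elim
    case (elim x)
    have "dual_density (real m) x = ennreal (x powr (real m * conj_exp p)) * ennreal (real_dual_weight x)"
      using elim by (simp add: dual_density_def)
    also have "\<dots> = ennreal (W * rho x)"
      using W(2) real_dual_weight_nonneg by (simp add: rho_def ennreal_mult)
    finally show ?case using W(2) rho_nonneg by (simp add: ennreal_mult)
  qed
  have "ennreal W * (\<integral>\<^sup>+x. ennreal (rho x) \<partial>lebesgue_on {a..<b}) = ennreal W"
  proof -
    have "ennreal W = (\<integral>\<^sup>+x. ennreal W * ennreal (rho x) \<partial>lebesgue_on {a..<b})"
      using nn_integral_cong_AE[OF dens_rho] W(1) by simp
    also have "\<dots> = ennreal W * (\<integral>\<^sup>+x. ennreal (rho x) \<partial>lebesgue_on {a..<b})"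
      using rho_m by (intro nn_integral_cmult measurable_compose[OF _ measurable_ennreal])
    finally show ?thesis by simp
  qed
  then have rho_one: "(\<integral>\<^sup>+x. ennreal (rho x) \<partial>lebesgue_on {a..<b}) = 1"
    using W(2) by (metis ennreal_mult_cancel_left ennreal_eq_0_iff ennreal_neq_top mult.right_neutral not_less)
  have rho_int: "integrable (lebesgue_on {a..<b}) rho"
    using rho_m rho_nonneg rho_one by (intro integrableI_nonneg) auto
  have rho_int_one: "(LINT x|lebesgue_on {a..<b}. rho x) = 1"
    using nn_integral_eq_integral[OF rho_int] rho_nonneg rho_one by simp
  have int_k: "integrable (lebesgue_on {a..<b}) (\<lambda>x. x ^ k / x ^ m * rho x)" for k
  proof (rule Bochner_Integration.integrable_bound)
    show "integrable (lebesgue_on {a..<b}) (\<lambda>x. b ^ k / a ^ m * rho x)" using rho_int by simp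
    show "(\<lambda>x. x ^ k / x ^ m * rho x) \<in> borel_measurable (lebesgue_on {a..<b})"
      by (intro borel_measurable_times pow_m rho_m)
    show "AE x in lebesgue_on {a..<b}. norm (x ^ k / x ^ m * rho x) \<le> norm (b ^ k / a ^ m * rho x)"
      using in_ab
    proof eventually_elim
      case (elim x)
      then have "x ^ k / x ^ m \<le> b ^ k / a ^ m"
        using ab by (intro frac_le power_mono) auto
      moreover have "0 \<le> x ^ k / x ^ m" using elim ab by simp
      ultimately have "0 \<le> x ^ k / x ^ m * rho x" "x ^ k / x ^ m * rho x \<le> b ^ k / a ^ m * rho x"
        using rho_nonneg[of x] by (auto intro: mult_right_mono mult_nonneg_nonneg simp del: times_divide_eq_left)
      then show ?case unfolding real_norm_def by linarith
    qed
  qed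
  show ?thesis
  proof (rule that[of phi y])
    have "(\<lambda>x. rho x / x ^ m * indicator {a..<b} x) \<in> borel_measurable (lebesgue_on {0<..})"
    proof (intro borel_measurable_times borel_measurable_divide rho_m0)
      show "(\<lambda>x::real. x ^ m) \<in> borel_measurable (lebesgue_on {0<..})"
        by (rule continuous_imp_measurable_on_sets_lebesgue) (auto intro!: continuous_intros)
      have eq: "{x \<in> space (lebesgue_on {0<..}). x \<in> {a..<b}} = {a..<b}"
        using sub by (auto simp: space_restrict_space)
      have "{a..<b} \<in> sets (lebesgue_on {0<..})"
        using sub by (simp add: sets_restrict_space_iff)
      then show "(\<lambda>x. indicator {a..<b} x :: real) \<in> borel_measurable (lebesgue_on {0<..})"
        by (intro borel_measurable_indicator') (simp only: eq)
    qed
    moreover have "(\<lambda>x. rho x / x ^ m * indicator {a..<b} x) = phi" by (auto simp: phi_def fun_eq_iff)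
    ultimately show phi_m: "phi \<in> borel_measurable (lebesgue_on {0<..})" by simp
    show "has_bochner_integral (lebesgue_on A) (\<lambda>x. x ^ k * phi x) (y k)"
      if A: "{a..<b} \<subseteq> A" "A \<in> sets lebesgue" for A k
    proof -
      have eq: "(\<lambda>x. indicat_real A x * (x ^ k * phi x)) = (\<lambda>x. indicat_real {a..<b} x * (x ^ k * rho x) / x ^ m)"
        using A(1) by (auto simp: fun_eq_iff phi_def indicator_def)
      show ?thesis
        using int_k[of k] A(2) unfolding y_def has_bochner_integral_iff
        by (simp add: integrable_restrict_space integral_restrict_space eq)
    qed
    show "\<exists>x\<in>{a..<b}. (\<Sum>k\<le>n. c k * y k) = (\<Sum>k\<le>n. c k * x ^ k) / x ^ m" for n c
    proof -
      define g where "g x = (\<Sum>k\<le>n. c k * x ^ k) / x ^ m" for x :: real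
      have g_eq: "g x * rho x = (\<Sum>k\<le>n. c k * (x ^ k / x ^ m * rho x))" for x
        by (simp add: g_def sum_divide_distrib sum_distrib_right mult.assoc)
      have "integrable (lebesgue_on {a..<b}) (\<lambda>x. g x * rho x)"
        unfolding g_eq by (intro Bochner_Integration.integrable_sum integrable_mult_right int_k)
      moreover have "continuous_on {0<..} g"
        unfolding g_def[abs_def] by (auto intro!: continuous_intros)
      ultimately obtain x where x: "x \<in> {a..<b}" "(LINT x|lebesgue_on {a..<b}. g x * rho x) = g x"
        using weighted_mean_value[OF ab _ rho_int rho_nonneg rho_int_one] by blast
      moreover have "(LINT x|lebesgue_on {a..<b}. g x * rho x) = (\<Sum>k\<le>n. c k * y k)"
        unfolding g_eq y_def
        by (subst Bochner_Integration.integral_sum)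
          (intro integrable_mult_right int_k, simp only: integral_mult_right_zero)
      ultimately have "(\<Sum>k\<le>n. c k * y k) = g x" by simp
      then show ?thesis unfolding g_def using x(1) by blast
    qed
    have m_uphi: "(\<lambda>x. u x * ennreal \<bar>phi x\<bar>) \<in> borel_measurable (lebesgue_on {0<..})"
      by (intro borel_measurable_times_ennreal u_measurable measurable_compose[OF _ measurable_ennreal]
          borel_measurable_abs phi_m)
    have uphi: "AE x in lebesgue_on {0<..}. x \<in> {a..<b} \<longrightarrow>
        (\<exists>c>0. u x = ennreal c \<and> dual_weight x = ennreal (c powr - conj_exp p) \<and>
          u x * ennreal \<bar>phi x\<bar> = ennreal (x powr (real m * (conj_exp p - 1)) * c powr (1 - conj_exp p) / W))"
      using AE_weight_pos_finite
    proof eventually_elim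
      case (elim x)
      show ?case
      proof
        assume x: "x \<in> {a..<b}"
        obtain c where c: "u x = ennreal c" "0 < c" using elim by (cases "u x") auto
        have w: "dual_weight x = ennreal (c powr - conj_exp p)"
          using c by (simp add: dual_weight_def inverse_ennreal ennpowr_ennreal powr_minus inverse_powr)
        have "\<bar>phi x\<bar> = x powr (real m * conj_exp p) * c powr - conj_exp p / W / x powr real m"
          using x ab W(2) rho_nonneg[of x] by (simp add: phi_def rho_def real_dual_weight_def w powr_realpow)
        also have "\<dots> = x powr (real m * (conj_exp p - 1)) * c powr - conj_exp p / W"
          by (simp add: right_diff_distrib powr_diff)
        finally have "c * \<bar>phi x\<bar> = x powr (real m * (conj_exp p - 1)) * c powr (1 - conj_exp p) / W"
          using c by (simp add: powr_diff powr_minus field_simps)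
        then show "\<exists>c>0. u x = ennreal c \<and> dual_weight x = ennreal (c powr - conj_exp p) \<and>
          u x * ennreal \<bar>phi x\<bar> = ennreal (x powr (real m * (conj_exp p - 1)) * c powr (1 - conj_exp p) / W)"
          using c w by (auto simp: ennreal_mult[symmetric])
      qed
    qed
    show "lp_norm p {0<..} (\<lambda>x. u x * ennreal \<bar>phi x\<bar>) * ennpowr (ennreal W) (1 / conj_exp p) \<le> 1"
    proof (cases "p = \<infinity>")
      case True
      have one: "conj_exp p = 1" by (simp add: True conj_exp_def)
      have "AE x in lebesgue_on {0<..}. u x * ennreal \<bar>phi x\<bar> \<le> ennreal (1 / W)"
        using uphi
      proof eventually_elim
        case (elim x)
        show ?case
        proof (cases "x \<in> {a..<b}")
          case True
          then show ?thesis using elim ab by (auto simp: one)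
        qed (auto simp: phi_def)
      qed
      then have "lp_norm p {0<..} (\<lambda>x. u x * ennreal \<bar>phi x\<bar>) \<le> ennreal (1 / W)"
        using m_uphi by (auto simp: True lp_norm_infinity)
      then have "lp_norm p {0<..} (\<lambda>x. u x * ennreal \<bar>phi x\<bar>) * ennreal W \<le> ennreal (1 / W) * ennreal W"
        by (rule mult_right_mono) simp
      then show ?thesis using W(2) by (simp add: one ennreal_mult[symmetric])
    next
      case False
      define P where "P = enn2real p"
      have P: "1 < P" "(conj_exp p - 1) * P = conj_exp p" "1 / P + 1 / conj_exp p = 1"
        using enn2real_gt_1[OF p False] conj_exp_conjugate[OF p False] by (auto simp: P_def)
      have "(\<integral>\<^sup>+x. ennpowr (u x * ennreal \<bar>phi x\<bar>) P \<partial>lebesgue_on {0<..})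
          = (\<integral>\<^sup>+x. ennreal (W powr - P) * dual_density (real m) x * indicator {a..<b} x \<partial>lebesgue_on {0<..})"
      proof (rule nn_integral_cong_AE)
        show "AE x in lebesgue_on {0<..}. ennpowr (u x * ennreal \<bar>phi x\<bar>) P =
            ennreal (W powr - P) * dual_density (real m) x * indicator {a..<b} x"
          using uphi
        proof eventually_elim
          case (elim x)
          show ?case
          proof (cases "x \<in> {a..<b}")
            case True
            then obtain c where c: "c > 0" "dual_weight x = ennreal (c powr - conj_exp p)"
              "u x * ennreal \<bar>phi x\<bar> = ennreal (x powr (real m * (conj_exp p - 1)) * c powr (1 - conj_exp p) / W)"
              using elim by auto
            have e: "real m * (conj_exp p - 1) * P = real m * conj_exp p" "(1 - conj_exp p) * P = - conj_exp p"
              using P(2) by (simp_all add: mult.assoc left_diff_distrib)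
            have "(x powr (real m * (conj_exp p - 1)) * c powr (1 - conj_exp p) / W) powr P =
               W powr - P * (x powr (real m * conj_exp p) * c powr - conj_exp p)"
              using W(2) by (simp add: powr_divide powr_mult powr_powr e powr_minus divide_inverse inverse_powr)
            then show ?thesis
              using True c W(2) by (simp add: ennpowr_ennreal dual_density_def ennreal_mult)
          qed (auto simp: phi_def)
        qed
      qed
      also have "\<dots> = (\<integral>\<^sup>+x. ennreal (W powr - P) * dual_density (real m) x \<partial>lebesgue_on {a..<b})"
        using ab by (auto simp: nn_integral_restrict_space intro!: nn_integral_cong split: split_indicator)
      also have "\<dots> = ennreal (W powr - P) * ennreal W"
        using borel_measurable_lebesgue_on_mono[OF sub dual_density_measurable, of "real m"]
        by (simp add: nn_integral_cmult W(1))
      also have "\<dots> = ennreal (W powr (1 - P))"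
        using W(2) by (simp add: ennreal_mult[symmetric] powr_diff powr_minus field_simps)
      finally have "lp_norm p {0<..} (\<lambda>x. u x * ennreal \<bar>phi x\<bar>) = ennreal (W powr ((1 - P) * (1 / P)))"
        using False by (simp add: lp_norm_finite P_def ennpowr_ennreal powr_powr)
      moreover have "(1 - P) * (1 / P) + 1 / conj_exp p = 0"
        using P by (simp add: field_simps)
      then have "W powr ((1 - P) * (1 / P)) * W powr (1 / conj_exp p) = 1"
        using W(2) by (simp flip: powr_add)
      ultimately show ?thesis using W(2) by (simp add: ennpowr_ennreal ennreal_mult[symmetric])
    qed
  qed
qed

end

section \<open>Test functions with a single moment\<close>

context hardy_weight
begin

lemma weighted_norm_real_sum_le:
  assumes "finite I" "\<And>i. i \<in> I \<Longrightarrow> phi i \<in> borel_measurable (lebesgue_on {0<..})"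
  shows "weighted_norm p u (\<lambda>x. complex_of_real (\<Sum>i\<in>I. \<beta> i * phi i x)) \<le>
     (\<Sum>i\<in>I. ennreal \<bar>\<beta> i\<bar> * lp_norm p {0<..} (\<lambda>x. u x * ennreal \<bar>phi i x\<bar>))"
proof -
  have m: "(\<lambda>x. u x * ennreal \<bar>g x\<bar>) \<in> borel_measurable (lebesgue_on {0<..})"
    if "g \<in> borel_measurable (lebesgue_on {0<..})" for g :: "real \<Rightarrow> real"
    by (intro borel_measurable_times_ennreal u_measurable measurable_compose[OF _ measurable_ennreal]
        borel_measurable_abs that)
  have m2: "(\<lambda>x. ennreal \<bar>\<beta> i\<bar> * (u x * ennreal \<bar>phi i x\<bar>)) \<in> borel_measurable (lebesgue_on {0<..})" if "i \<in> I" for i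
    by (intro borel_measurable_times_ennreal borel_measurable_const m assms that)
  have "weighted_norm p u (\<lambda>x. complex_of_real (\<Sum>i\<in>I. \<beta> i * phi i x)) \<le>
     lp_norm p {0<..} (\<lambda>x. \<Sum>i\<in>I. ennreal \<bar>\<beta> i\<bar> * (u x * ennreal \<bar>phi i x\<bar>))"
    unfolding weighted_norm_def norm_of_real
  proof (rule lp_norm_mono_AE[OF p m], intro borel_measurable_sum borel_measurable_times borel_measurable_const assms, assumption, rule AE_I2)
    fix x
    have "u x * ennreal \<bar>\<Sum>i\<in>I. \<beta> i * phi i x\<bar> \<le> u x * ennreal (\<Sum>i\<in>I. \<bar>\<beta> i\<bar> * \<bar>phi i x\<bar>)"
      using sum_abs[of "\<lambda>i. \<beta> i * phi i x" I] by (intro mult_left_mono ennreal_leI) (auto simp: abs_mult)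
    also have "\<dots> = (\<Sum>i\<in>I. ennreal \<bar>\<beta> i\<bar> * (u x * ennreal \<bar>phi i x\<bar>))"
      by (simp add: sum_distrib_left ennreal_mult ac_simps flip: sum_ennreal)
    finally show "u x * ennreal \<bar>\<Sum>i\<in>I. \<beta> i * phi i x\<bar> \<le> (\<Sum>i\<in>I. ennreal \<bar>\<beta> i\<bar> * (u x * ennreal \<bar>phi i x\<bar>))" .
  qed
  also have "\<dots> \<le> (\<Sum>i\<in>I. lp_norm p {0<..} (\<lambda>x. ennreal \<bar>\<beta> i\<bar> * (u x * ennreal \<bar>phi i x\<bar>)))"
    by (rule lp_norm_sum_le[OF p assms(1) m2])
  also have "\<dots> \<le> (\<Sum>i\<in>I. ennreal \<bar>\<beta> i\<bar> * lp_norm p {0<..} (\<lambda>x. u x * ennreal \<bar>phi i x\<bar>))"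
    by (intro sum_mono lp_norm_cmult_le p m assms)
  finally show ?thesis .
qed

text \<open>On \<open>n + 1\<close> intervals \<open>I 0, \<dots>, I n\<close> in \<open>(0, r)\<close>, ordered from right to left, place the bumps from above;
a suitable linear combination has all moments up to order \<open>n\<close> equal to zero except the \<open>j\<close>-th, which
is \<open>1\<close>. Its norm is at most the sum of \<open>|\<beta> i| * (mass of I i) powr (- 1 / p')\<close>, so it remains to give
the intervals enough mass.

Let \<open>m = min j (n - 1)\<close>, the largest exponent up to \<open>j\<close> for which the mass with density
\<open>x\<^bsup>m p'\<^esup> u\<^bsup>-p'\<^esup>\<close> is known to be doubling. The first interval \<open>I 0 = [t, r)\<close> takes half of the mass for
the exponent \<open>j\<close>, which requires no doubling; the later ones halve the mass for the exponent \<open>m\<close>, and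
doubling shows that each of them carries a fixed fraction of the \<open>m\<close>-mass of \<open>(0, t)\<close>. For \<open>j < n\<close> this is
all. For \<open>j = n\<close> the exponent is one too small from the second interval on, but then \<open>\<beta> i\<close> is smaller by the
factor \<open>1 / t\<close>, and \<open>t\<^bsup>p'\<^esup>\<close> times the \<open>(n - 1)\<close>-mass of \<open>(0, t)\<close> dominates its \<open>n\<close>-mass. This
compensation is the reason why doubling for \<open>n - 1\<close> suffices.\<close>

lemma test_function:
  assumes n: "1 \<le> n" and D: "0 \<le> D"
    and doubling: "\<And>r. 0 < r \<Longrightarrow> dual_integral p u (real n - 1) (2 * r)
               \<le> ennreal D * dual_integral p u (real n - 1) r"
    and r: "0 < r" and j: "j \<le> n"
  obtains f where "f \<in> weighted_space p u"
    "\<And>k x. k \<le> n \<Longrightarrow> r \<le> x \<Longrightarrow> hardy k f x = (if k = j then 1 else 0)"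
    "weighted_norm p u f * ennpowr (dual_integral p u (real j) r) (1 / conj_exp p)
       \<le> ennreal (real (Suc n) * (3 ^ n * (4 * (2 * (1 + D)) ^ n)))"
proof -
  define m where "m = min j (n - 1)"
  \<comment> \<open>The exponent used on the \<open>i\<close>-th interval.\<close>
  define mm where "mm i = (if i = 0 then j else m)" for i :: nat
  define E where "E = 1 + D"
  have E: "1 \<le> E" using D by (simp add: E_def)
  have m: "m \<le> n - 1" "m \<le> j" and jm: "j = m \<or> (j = n \<and> Suc m = n)"
    using j n by (auto simp: m_def)
  have dbl: "primitive (dual_density (real m)) (2 * t) \<le> ennreal E * primitive (dual_density (real m)) t" if "0 < t" for t
  proof -
    have "primitive (dual_density (real m)) (2 * t) \<le> (1 + ennreal D) * primitive (dual_density (real m)) t"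
      by (rule doubling_transfer[of "real n - 1"])
        (use doubling that m n in \<open>auto simp: dual_integral_eq_primitive\<close>)
    moreover have "1 + ennreal D = ennreal E" using D by (simp add: E_def)
    ultimately show ?thesis by simp
  qed
  obtain z where z0: "z 0 = r" and z_pos: "\<And>i. 0 < z i" and z_less: "\<And>i. 2 * z (Suc i) < z i"
    and z_half: "\<And>i. primitive (dual_density (real (mm i))) (z i) = 2 * primitive (dual_density (real (mm i))) (2 * z (Suc i))"
    and z_int: "\<And>i. (\<integral>\<^sup>+x. dual_density (real (mm i)) x \<partial>lebesgue_on {2 * z (Suc i)..<z i})
        = primitive (dual_density (real (mm i))) (2 * z (Suc i))"
    using halving_points[of "\<lambda>i. real (mm i)" r] r by (metis of_nat_0_le_iff)
  have z_anti: "z i \<le> z l" if "l \<le> i" for i l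
    using that
  proof (induction rule: dec_induct)
    case (step i)
    then show ?case using z_less[of i] z_pos[of "Suc i"] by linarith
  qed simp
  define I where "I i = {2 * z (Suc i)..<z i}" for i
  define W where "W i = enn2real (primitive (dual_density (real (mm i))) (2 * z (Suc i)))" for i
  have W: "primitive (dual_density (real (mm i))) (2 * z (Suc i)) = ennreal (W i)" "0 < W i" for i
    using primitive_dual_density_finite[of "real (mm i)" "2 * z (Suc i)"] primitive_dual_density_pos[of "2 * z (Suc i)" "real (mm i)"]
      z_pos[of "Suc i"] by (auto simp: W_def less_top enn2real_positive_iff)
  define Q where "Q i phi y \<longleftrightarrow> phi \<in> borel_measurable (lebesgue_on {0<..}) \<and>
      (\<forall>A k. I i \<subseteq> A \<longrightarrow> A \<in> sets lebesgue \<longrightarrow> has_bochner_integral (lebesgue_on A) (\<lambda>x. x ^ k * phi x) (y k)) \<and>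
      (\<forall>n c. \<exists>x\<in>I i. (\<Sum>k\<le>n. c k * y k) = (\<Sum>k\<le>n. c k * x ^ k) / x ^ mm i) \<and>
      lp_norm p {0<..} (\<lambda>x. u x * ennreal \<bar>phi x\<bar>) * ennpowr (ennreal (W i)) (1 / conj_exp p) \<le> 1"
    for i phi and y :: "nat \<Rightarrow> real"
  have "\<exists>phi y. Q i phi y" for i
  proof -
    have ab: "0 < 2 * z (Suc i)" "2 * z (Suc i) < z i" using z_pos z_less by simp_all
    have int: "(\<integral>\<^sup>+x. dual_density (real (mm i)) x \<partial>lebesgue_on {2 * z (Suc i)..<z i}) = ennreal (W i)"
      using z_int W(1) by simp
    obtain phi y where b: "phi \<in> borel_measurable (lebesgue_on {0<..})"
      "\<And>A k. I i \<subseteq> A \<Longrightarrow> A \<in> sets lebesgue \<Longrightarrow> has_bochner_integral (lebesgue_on A) (\<lambda>x. x ^ k * phi x) (y k)"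
      "\<And>n c. \<exists>x\<in>I i. (\<Sum>k\<le>n. c k * y k) = (\<Sum>k\<le>n. c k * x ^ k) / x ^ mm i"
      "lp_norm p {0<..} (\<lambda>x. u x * ennreal \<bar>phi x\<bar>) * ennpowr (ennreal (W i)) (1 / conj_exp p) \<le> 1"
      by (rule bump[OF ab int W(2), folded I_def]) (rule that)
    show ?thesis unfolding Q_def
      by (intro exI[of _ phi] exI[of _ y] conjI allI impI b)
  qed
  then obtain phi y where Q: "\<And>i. Q i (phi i) (y i)" by metis
  have phi: "phi i \<in> borel_measurable (lebesgue_on {0<..})"
    and phi_int: "I i \<subseteq> A \<Longrightarrow> A \<in> sets lebesgue \<Longrightarrow>
      has_bochner_integral (lebesgue_on A) (\<lambda>x. x ^ k * phi i x) (y i k)"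
    and phi_mean: "\<exists>x\<in>I i. (\<Sum>k\<le>N. c k * y i k) = (\<Sum>k\<le>N. c k * x ^ k) / x ^ mm i"
    and phi_norm: "lp_norm p {0<..} (\<lambda>x. u x * ennreal \<bar>phi i x\<bar>) * ennpowr (ennreal (W i)) (1 / conj_exp p) \<le> 1"
    for i A k N c
    using Q[of i] unfolding Q_def by simp_all
  have I_pos: "0 < x" if "x \<in> I i" for i x using that z_pos[of "Suc i"] by (auto simp: I_def)
  have I_sep: "2 * w \<le> x" if "l < i" "x \<in> I l" "w \<in> I i" for l i x w
    using that z_anti[of "Suc l" i] by (auto simp: I_def)
  define t where "t = 2 * z 1"
  have t: "0 < t" using z_pos[of 1] by (simp add: t_def)
  obtain \<beta> where
    beta: "\<And>k. k \<le> n \<Longrightarrow> (\<Sum>i\<le>n. y i k * \<beta> i) = (if k = j then 1 else 0)"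
    and beta_le: "\<And>i. i \<le> n \<Longrightarrow> mm i = j \<Longrightarrow> \<bar>\<beta> i\<bar> \<le> 3 ^ n"
    and beta_le': "\<And>i t. 0 < i \<Longrightarrow> i \<le> n \<Longrightarrow> Suc (mm i) = n \<Longrightarrow> j = n \<Longrightarrow> 0 < t \<Longrightarrow> (\<And>x. x \<in> I 0 \<Longrightarrow> t \<le> x) \<Longrightarrow>
       \<bar>\<beta> i\<bar> \<le> 3 ^ n / t"
    by (rule moment_dual_basis[of n I "\<lambda>k i. y i k" mm j]) (use phi_mean I_pos I_sep j in \<open>blast+\<close>)
  define f where "f x = complex_of_real (\<Sum>i\<le>n. \<beta> i * phi i x)" for x
  define L where "L i = lp_norm p {0<..} (\<lambda>x. u x * ennreal \<bar>phi i x\<bar>)" for i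
  \<comment> \<open>\<open>V\<close> below is the \<open>j\<close>-mass of \<open>(0, r)\<close>; up to the factor \<open>t powr ((j - m) * p')\<close> each interval
    \<open>I i\<close> with \<open>i \<ge> 1\<close> has \<open>m\<close>-mass at least \<open>V / K\<close>.\<close>
  define K where "K = 4 * (2 * E) ^ n"
  define s where "s = 1 / conj_exp p"
  have s: "0 < s" "s \<le> 1" using conj_exp_ge_1[OF p] by (auto simp: s_def)
  define V where "V = enn2real (primitive (dual_density (real j)) r)"
  have V: "primitive (dual_density (real j)) r = ennreal V" "0 < V"
    using primitive_dual_density_finite[of "real j" r] primitive_dual_density_pos[OF r, of "real j"] r
    by (auto simp: V_def less_top enn2real_positive_iff)
  have K1: "4 \<le> K" using E one_le_power[of "2 * E" n] by (simp add: K_def)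
  have growth: "primitive (dual_density (real m)) (2 * z 1) \<le> ennreal ((2 * E) ^ i) * primitive (dual_density (real m)) (z i)"
    if "1 \<le> i" for i
    using that
  proof (induction rule: dec_induct)
    case base
    have "primitive (dual_density (real m)) (2 * z 1) \<le> ennreal E * primitive (dual_density (real m)) (z 1)"
      by (rule dbl) (rule z_pos)
    also have "\<dots> \<le> ennreal ((2 * E) ^ 1) * primitive (dual_density (real m)) (z 1)"
      using E by (intro mult_right_mono ennreal_leI) auto
    finally show ?case .
  next
    case (step i)
    have "primitive (dual_density (real m)) (z i) = 2 * primitive (dual_density (real m)) (2 * z (Suc i))"
      using z_half[of i] step by (simp add: mm_def)
    also have "\<dots> \<le> 2 * (ennreal E * primitive (dual_density (real m)) (z (Suc i)))"
      by (intro mult_left_mono dbl z_pos) simp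
    also have "\<dots> = ennreal (2 * E) * primitive (dual_density (real m)) (z (Suc i))"
      using E by (simp add: ennreal_mult mult.assoc)
    finally have "ennreal ((2 * E) ^ i) * primitive (dual_density (real m)) (z i) \<le>
        ennreal ((2 * E) ^ i) * (ennreal (2 * E) * primitive (dual_density (real m)) (z (Suc i)))"
      by (rule mult_left_mono) simp
    also have "\<dots> = ennreal ((2 * E) ^ Suc i) * primitive (dual_density (real m)) (z (Suc i))"
    proof -
      have "ennreal ((2 * E) ^ i) * ennreal (2 * E) = ennreal ((2 * E) ^ Suc i)"
        using ennreal_mult[of "(2 * E) ^ i" "2 * E"] E by (simp add: mult.commute)
      then show ?thesis by (simp only: mult.assoc[symmetric])
    qed
    finally show ?case using step.IH by (rule order_trans[rotated])
  qed
  have V0: "V = 2 * W 0"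
    using z_half[of 0] W[of 0] V by (simp add: z0 mm_def ennreal_mult[symmetric] flip: ennreal_numeral)
  have V_le: "V \<le> K * t powr (real (j - m) * conj_exp p) * W i" if i: "1 \<le> i" "i \<le> n" for i
  proof -
    have "ennreal (W 0) = primitive (dual_density (real j)) t"
      using W(1)[of 0] by (simp add: mm_def t_def)
    also have "\<dots> \<le> ennreal (t powr ((real j - real m) * conj_exp p)) * primitive (dual_density (real m)) t"
      using m t by (intro primitive_dual_density_le) auto
    also have "\<dots> \<le> ennreal (t powr ((real j - real m) * conj_exp p)) *
        (ennreal ((2 * E) ^ i) * primitive (dual_density (real m)) (z i))"
      using growth[OF i(1)] by (intro mult_left_mono) (auto simp: t_def)
    also have "primitive (dual_density (real m)) (z i) = ennreal (2 * W i)"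
      using z_half[of i] W[of i] i by (simp add: mm_def ennreal_mult)
    finally have "W 0 \<le> t powr ((real j - real m) * conj_exp p) * ((2 * E) ^ i * (2 * W i))"
      using E W(2)[of i] by (simp add: ennreal_mult[symmetric] ennreal_le_iff)
    also have "\<dots> \<le> t powr ((real j - real m) * conj_exp p) * ((2 * E) ^ n * (2 * W i))"
      using E i W(2)[of i] by (intro mult_left_mono mult_right_mono power_increasing) auto
    finally show ?thesis using m by (simp add: V0 K_def of_nat_diff mult_ac)
  qed
  have term_le: "ennreal \<bar>\<beta> i\<bar> * L i * ennpowr (ennreal V) s \<le> ennreal (3 ^ n * K)" if i: "i \<le> n" for i
  proof -
    have B: "\<bar>\<beta> i\<bar> * V powr s \<le> 3 ^ n * K * W i powr s"
    proof (cases "i = 0")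
      case True
      have "\<bar>\<beta> 0\<bar> \<le> 3 ^ n" by (rule beta_le) (auto simp: mm_def)
      moreover have "V powr s \<le> (K * W 0) powr s"
        using V0 V K1 W(2)[of 0] s by (intro powr_mono2) auto
      moreover have "K powr s \<le> K powr 1" using K1 s by (intro powr_mono) auto
      ultimately have "\<bar>\<beta> 0\<bar> * V powr s \<le> 3 ^ n * (K * W 0 powr s)"
        using K1 W(2)[of 0]
        by (intro mult_mono) (auto simp: powr_mult elim!: order_trans intro!: mult_right_mono)
      then show ?thesis using True by (simp add: mult.assoc)
    next
      case False
      then have i1: "1 \<le> i" by simp
      define d where "d = t powr real (j - m)"
      have d: "0 < d" using t by (simp add: d_def)
      have "\<bar>\<beta> i\<bar> \<le> 3 ^ n / d"
        using jm
      proof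
        assume "j = m"
        then show ?thesis using beta_le[OF i] i1 t by (simp add: mm_def d_def)
      next
        assume jn: "j = n \<and> Suc m = n"
        then have "j - m = 1" by auto
        then have "d = t" using t by (simp add: d_def)
        moreover have "\<bar>\<beta> i\<bar> \<le> 3 ^ n / t"
          by (rule beta_le') (use jn i i1 t in \<open>auto simp: mm_def I_def t_def\<close>)
        ultimately show ?thesis by simp
      qed
      then have b: "\<bar>\<beta> i\<bar> * d \<le> 3 ^ n" using d by (simp add: pos_le_divide_eq)
      have "V powr s \<le> (K * t powr (real (j - m) * conj_exp p) * W i) powr s"
        using V_le[OF i1 i] V s by (intro powr_mono2) auto
      also have "\<dots> = K powr s * d * W i powr s"
        using K1 W(2)[of i] conj_exp_pos[OF p] by (simp add: powr_mult powr_powr d_def s_def)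
      also have "\<dots> \<le> K powr 1 * d * W i powr s"
        using K1 s d by (intro mult_right_mono powr_mono) auto
      finally have "\<bar>\<beta> i\<bar> * V powr s \<le> \<bar>\<beta> i\<bar> * (K * d * W i powr s)"
        using K1 by (intro mult_left_mono) auto
      also have "\<dots> = (\<bar>\<beta> i\<bar> * d) * (K * W i powr s)" by (simp only: mult_ac)
      also have "\<dots> \<le> 3 ^ n * (K * W i powr s)" using b K1 by (intro mult_right_mono) auto
      finally show ?thesis by (simp add: mult.assoc)
    qed
    have "ennreal \<bar>\<beta> i\<bar> * L i * ennpowr (ennreal V) s = ennreal (\<bar>\<beta> i\<bar> * V powr s) * L i"
      using V by (simp add: ennpowr_ennreal ennreal_mult mult_ac)
    also have "\<dots> \<le> ennreal (3 ^ n * K * W i powr s) * L i"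
      using B by (intro mult_right_mono ennreal_leI) auto
    also have "\<dots> = ennreal (3 ^ n * K) * (L i * ennpowr (ennreal (W i)) s)"
      using W(2)[of i] K1 by (simp add: ennpowr_ennreal ennreal_mult mult_ac)
    also have "\<dots> \<le> ennreal (3 ^ n * K) * 1"
      using phi_norm[of i] by (intro mult_left_mono) (auto simp: L_def s_def)
    finally show ?thesis by simp
  qed
  have "weighted_norm p u f \<le> (\<Sum>i\<le>n. ennreal \<bar>\<beta> i\<bar> * L i)"
    unfolding f_def[abs_def] L_def by (rule weighted_norm_real_sum_le) (auto intro: phi)
  then have "weighted_norm p u f * ennpowr (ennreal V) s \<le> (\<Sum>i\<le>n. ennreal \<bar>\<beta> i\<bar> * L i) * ennpowr (ennreal V) s"
    by (rule mult_right_mono) simp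
  also have "\<dots> \<le> (\<Sum>i\<le>n. ennreal (3 ^ n * K))"
    unfolding sum_distrib_right by (rule sum_mono) (rule term_le, simp)
  also have "\<dots> = ennreal (real (Suc n) * (3 ^ n * K))"
    using K1 by (simp add: ennreal_mult ennreal_of_nat_eq_real_of_nat)
  finally have norm_le: "weighted_norm p u f * ennpowr (ennreal V) s \<le> ennreal (real (Suc n) * (3 ^ n * K))" .
  have f_space: "f \<in> weighted_space p u"
    unfolding weighted_space_def
  proof (intro CollectI conjI)
    show "f \<in> borel_measurable (lebesgue_on {0<..})"
      unfolding f_def[abs_def]
      by (intro measurable_compose[OF _ borel_measurable_of_real] borel_measurable_sum borel_measurable_times borel_measurable_const phi)
    show "weighted_norm p u f < \<infinity>"
    proof (rule ccontr)
      assume "\<not> ?thesis"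
      then have "weighted_norm p u f = top" by (metis infinity_ennreal_def less_top)
      then have "weighted_norm p u f * ennpowr (ennreal V) s = top"
        using V(2) by (simp add: ennreal_top_mult)
      with norm_le show False by (simp add: top_unique)
    qed
  qed
  show ?thesis
  proof (rule that[OF f_space])
    \<comment> \<open>The bumps live to the left of \<open>r\<close>, so that the Hardy integrals are full moments.\<close>
    fix k x assume k: "k \<le> n" and x: "r \<le> x"
    have sub: "I i \<subseteq> {0<..<x}" for i
      using I_pos[of _ i] z_anti[of 0 i] x z0 by (auto simp: I_def)
    have "has_bochner_integral (lebesgue_on {0<..<x}) (\<lambda>t. \<Sum>i\<le>n. \<beta> i * (t ^ k * phi i t)) (\<Sum>i\<le>n. \<beta> i * y i k)"
      by (intro has_bochner_integral_sum has_bochner_integral_mult_right phi_int sub) simp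
    then have "has_bochner_integral (lebesgue_on {0<..<x})
       (\<lambda>t. complex_of_real (\<Sum>i\<le>n. \<beta> i * (t ^ k * phi i t))) (complex_of_real (\<Sum>i\<le>n. \<beta> i * y i k))"
      by (rule has_bochner_integral_of_real)
    moreover have "(\<lambda>t. complex_of_real (\<Sum>i\<le>n. \<beta> i * (t ^ k * phi i t))) = (\<lambda>t. complex_of_real t ^ k * f t)"
      by (auto simp: f_def fun_eq_iff sum_distrib_left mult_ac)
    ultimately have "hardy k f x = complex_of_real (\<Sum>i\<le>n. \<beta> i * y i k)"
      unfolding hardy_def by (simp add: has_bochner_integral_integral_eq)
    also have "(\<Sum>i\<le>n. \<beta> i * y i k) = (if k = j then 1 else 0)"
      using beta[OF k] by (simp only: mult.commute)
    finally show "hardy k f x = (if k = j then 1 else 0)" by simp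
  next
    show "weighted_norm p u f * ennpowr (dual_integral p u (real j) r) (1 / conj_exp p)
       \<le> ennreal (real (Suc n) * (3 ^ n * (4 * (2 * (1 + D)) ^ n)))"
      using norm_le by (simp add: dual_integral_eq_primitive V s_def K_def E_def)
  qed
qed

text \<open>For the test function belonging to \<open>j\<close> and \<open>r\<close>, the whole sum collapses to \<open>a j x\<close> for \<open>x > r\<close>: no
cancellation between the different \<open>a k\<close> can occur.\<close>

lemma S_value_le:
  assumes n: "1 \<le> n" and D: "0 \<le> D"
    and doubling: "\<And>r. 0 < r \<Longrightarrow> dual_integral p u (real n - 1) (2 * r)
               \<le> ennreal D * dual_integral p u (real n - 1) r"
    and q: "p \<le> q" and v: "v \<in> borel_measurable (lebesgue_on {0<..})"
    and a: "\<And>k. k \<le> n \<Longrightarrow> a k \<in> borel_measurable (lebesgue_on {0<..})"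
    and c: "sum_bounded_by n a p q u v c" and j: "j \<le> n"
  shows "S_value a p q u v j \<le> ennreal (real (Suc n) * (3 ^ n * (4 * (2 * (1 + D)) ^ n))) * c"
  unfolding S_value_def
proof (rule SUP_least)
  fix r :: real assume "r \<in> {0<..}"
  then have r: "0 < r" by simp
  have q1: "1 < q" using p q by simp
  obtain f where f: "f \<in> weighted_space p u"
    "\<And>k x. k \<le> n \<Longrightarrow> r \<le> x \<Longrightarrow> hardy k f x = (if k = j then 1 else 0)"
    "weighted_norm p u f * ennpowr (dual_integral p u (real j) r) (1 / conj_exp p)
       \<le> ennreal (real (Suc n) * (3 ^ n * (4 * (2 * (1 + D)) ^ n)))"
    using test_function[OF n D doubling r j] by blast
  define g where "g x = v x * ennreal (cmod (\<Sum>k\<le>n. a k x * hardy k f x))" for x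
  have sub: "{r<..} \<subseteq> {0<..}" using r by auto
  have m: "(\<lambda>x. ennreal (cmod (a j x)) * v x) \<in> borel_measurable (lebesgue_on {r<..})"
    by (rule borel_measurable_lebesgue_on_mono[OF sub]) (use a[OF j] v in measurable)
  have "lp_norm q {r<..} (\<lambda>x. ennreal (cmod (a j x)) * v x) \<le> lp_norm q {r<..} g"
  proof (rule lp_norm_mono_AE[OF q1 m], rule AE_I2)
    fix x assume "x \<in> space (lebesgue_on {r<..})"
    then have "r \<le> x" by (simp add: space_restrict_space)
    then have "(\<Sum>k\<le>n. a k x * hardy k f x) = (\<Sum>k\<le>n. if k = j then a k x else 0)"
      using f(2) by (intro sum.cong) auto
    then show "ennreal (cmod (a j x)) * v x \<le> g x"
      using j by (simp add: g_def mult.commute)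
  qed
  also have "\<dots> \<le> lp_norm q {0<..} g" by (rule lp_norm_subset[OF q1 sub]) auto
  also have "\<dots> \<le> c * weighted_norm p u f"
    using c f(1) unfolding sum_bounded_by_def weighted_norm_def g_def by blast
  finally have "lp_norm q {r<..} (\<lambda>x. ennreal (cmod (a j x)) * v x) *
      ennpowr (dual_integral p u (real j) r) (1 / conj_exp p) \<le>
    c * weighted_norm p u f * ennpowr (dual_integral p u (real j) r) (1 / conj_exp p)"
    by (rule mult_right_mono) simp
  also have "\<dots> \<le> c * ennreal (real (Suc n) * (3 ^ n * (4 * (2 * (1 + D)) ^ n)))"
    unfolding mult.assoc[of c] using f(3) by (rule mult_left_mono) simp
  finally show "lp_norm q {r<..} (\<lambda>x. ennreal (cmod (a j x)) * v x) *
      ennpowr (dual_integral p u (real j) r) (1 / conj_exp p)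
    \<le> ennreal (real (Suc n) * (3 ^ n * (4 * (2 * (1 + D)) ^ n))) * c"
    by (simp add: mult.commute)
qed

end

section \<open>The equivalence\<close>

theorem theorem2p1:
  fixes p q :: ennreal
  assumes "1 < p" and "p \<le> q"
  shows "\<exists>K1::real. K1 > 0 \<and> (\<forall>n::nat. \<forall>D::real. n \<ge> 1 \<longrightarrow> (\<exists>K2::real.
    \<forall>(a :: nat \<Rightarrow> real \<Rightarrow> complex) (u :: real \<Rightarrow> ennreal) (v :: real \<Rightarrow> ennreal).
      (\<forall>k\<le>n. a k \<in> borel_measurable (lebesgue_on {0<..})) \<longrightarrow>
      weight u \<longrightarrow> weight v \<longrightarrow>
      (\<forall>r>0. dual_integral p u 0 r < \<infinity>) \<longrightarrow>
      (\<forall>r>0. dual_integral p u (real n - 1) (2 * r)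
               \<le> ennreal D * dual_integral p u (real n - 1) r) \<longrightarrow>
      ((\<exists>c<\<infinity>. sum_bounded_by n a p q u v c)
        \<longleftrightarrow> (\<exists>c :: nat \<Rightarrow> ennreal. \<forall>k\<le>n. c k < \<infinity> \<and>
              (\<forall>f\<in>weighted_space p u.
                 weighted_norm q v (\<lambda>x. a k x * hardy k f x) \<le> c k * weighted_norm p u f))) \<and>
      ((\<exists>c<\<infinity>. sum_bounded_by n a p q u v c)
        \<longleftrightarrow> (\<forall>k\<le>n. S_value a p q u v k < \<infinity>)) \<and>
      ennreal K1 * best_constant n a p q u v \<le> (\<Sum>k\<le>n. S_value a p q u v k) \<and>
      (\<Sum>k\<le>n. S_value a p q u v k) \<le> ennreal K2 * best_constant n a p q u v))"
proof -
  have main: "((\<exists>c<\<infinity>. sum_bounded_by n a p q u v c)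
        \<longleftrightarrow> (\<exists>c :: nat \<Rightarrow> ennreal. \<forall>k\<le>n. c k < \<infinity> \<and>
              (\<forall>f\<in>weighted_space p u.
                 weighted_norm q v (\<lambda>x. a k x * hardy k f x) \<le> c k * weighted_norm p u f))) \<and>
      ((\<exists>c<\<infinity>. sum_bounded_by n a p q u v c)
        \<longleftrightarrow> (\<forall>k\<le>n. S_value a p q u v k < \<infinity>)) \<and>
      ennreal (1 / 4) * best_constant n a p q u v \<le> (\<Sum>k\<le>n. S_value a p q u v k) \<and>
      (\<Sum>k\<le>n. S_value a p q u v k) \<le>
        ennreal (real (Suc n) * (real (Suc n) * (3 ^ n * (4 * (2 * (1 + max 0 D)) ^ n)))) * best_constant n a p q u v"
    (is "(?i \<longleftrightarrow> ?ii) \<and> (?i \<longleftrightarrow> ?iii) \<and> ?lower \<and> ?upper")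
    if n: "1 \<le> n" and a: "\<forall>k\<le>n. a k \<in> borel_measurable (lebesgue_on {0<..})"
      and u: "weight u" and v: "weight v" and fin: "\<forall>r>0. dual_integral p u 0 r < \<infinity>"
      and doubling: "\<forall>r>0. dual_integral p u (real n - 1) (2 * r)
               \<le> ennreal D * dual_integral p u (real n - 1) r"
    for n and D :: real and a u v
  proof -
    interpret hardy_weight p u
      by unfold_locales (use assms u fin in auto)
    define K where "K = real (Suc n) * (3 ^ n * (4 * (2 * (1 + max 0 D)) ^ n))"
    have K: "0 < K" by (simp add: K_def)
    have vm: "v \<in> borel_measurable (lebesgue_on {0<..})" using v by (simp add: weight_def)
    have am: "a k \<in> borel_measurable (lebesgue_on {0<..})" if "k \<le> n" for k using a that by blast
    \<comment> \<open>A negative \<open>D\<close> is read as \<open>0\<close> by \<open>ennreal\<close>.\<close>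
    have doubling': "dual_integral p u (real n - 1) (2 * r)
        \<le> ennreal (max 0 D) * dual_integral p u (real n - 1) r" if "0 < r" for r
    proof -
      have "ennreal (max 0 D) = ennreal D" by (cases "0 \<le> D") (auto simp: max_def ennreal_neg)
      then show ?thesis using doubling that by simp
    qed
    have S_le: "S_value a p q u v j \<le> ennreal K * c" if "sum_bounded_by n a p q u v c" "j \<le> n" for c j
      unfolding K_def
      by (rule S_value_le[where a = a, OF n _ doubling' assms(2) vm am that(1) that(2)]) simp_all
    have comp: "weighted_norm q v (\<lambda>x. a k x * hardy k f x) \<le> 4 * S_value a p q u v k * weighted_norm p u f"
      if "k \<le> n" "f \<in> weighted_space p u" for k f
      by (rule hardy_component_bound[where a = a, OF assms(2) vm am[OF that(1)] that(2)])
    have bounded: "sum_bounded_by n a p q u v (\<Sum>k\<le>n. 4 * S_value a p q u v k)"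
      by (rule sum_bounded_by_components[where a = a, OF assms(2) vm am comp])
    have "?i" if "?ii"
    proof -
      from that obtain c where c': "\<forall>k\<le>n. c k < \<infinity> \<and> (\<forall>f\<in>weighted_space p u.
          weighted_norm q v (\<lambda>x. a k x * hardy k f x) \<le> c k * weighted_norm p u f)" ..
      then have c: "k \<le> n \<Longrightarrow> c k < \<infinity>" "k \<le> n \<Longrightarrow> f \<in> weighted_space p u \<Longrightarrow>
          weighted_norm q v (\<lambda>x. a k x * hardy k f x) \<le> c k * weighted_norm p u f" for k f
        by simp_all
      have "sum_bounded_by n a p q u v (\<Sum>k\<le>n. c k)"
        by (rule sum_bounded_by_components[where a = a, OF assms(2) vm am c(2)])
      moreover have "(\<Sum>k\<le>n. c k) < \<infinity>" using c(1) by simp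
      ultimately show ?thesis by blast
    qed
    moreover have "?iii" if "?i"
    proof (intro allI impI)
      fix k assume "k \<le> n"
      from that obtain c where "c < \<infinity>" "sum_bounded_by n a p q u v c" by blast
      then show "S_value a p q u v k < \<infinity>"
        using S_le[of c k] \<open>k \<le> n\<close> by (auto simp: ennreal_mult_less_top elim!: order_le_less_trans)
    qed
    moreover have "?ii" if "?iii"
      by (rule exI[of _ "\<lambda>k. 4 * S_value a p q u v k"])
        (use that comp in \<open>auto simp: ennreal_mult_less_top\<close>)
    ultimately have equiv: "?i \<longleftrightarrow> ?ii" "?i \<longleftrightarrow> ?iii" by blast+
    have lower: ?lower
    proof (cases "(\<Sum>k\<le>n. S_value a p q u v k) < \<infinity>")
      case True
      have eq: "(\<Sum>k\<le>n. 4 * S_value a p q u v k) = 4 * (\<Sum>k\<le>n. S_value a p q u v k)"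
        by (simp add: sum_distrib_left)
      have "(\<Sum>k\<le>n. 4 * S_value a p q u v k) < \<infinity>"
        unfolding eq using True by (simp add: ennreal_mult_less_top)
      then have "best_constant n a p q u v \<le> 4 * (\<Sum>k\<le>n. S_value a p q u v k)"
        unfolding best_constant_def eq[symmetric] using bounded by (intro Inf_lower) simp
      then have "ennreal (1 / 4) * best_constant n a p q u v \<le> ennreal (1 / 4) * (4 * (\<Sum>k\<le>n. S_value a p q u v k))"
        by (rule mult_left_mono) simp
      also have "\<dots> = (\<Sum>k\<le>n. S_value a p q u v k)"
      proof -
        have "ennreal (1 / 4) * 4 = 1"
          using ennreal_mult[of "1 / 4" 4] by simp
        then show ?thesis by (simp only: mult.assoc[symmetric] mult_1)
      qed
      finally show ?thesis .
    next
      case False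
      then have "(\<Sum>k\<le>n. S_value a p q u v k) = top" by (metis infinity_ennreal_def less_top)
      then show ?thesis by (simp only: top_greatest)
    qed
    have upper: ?upper
    proof -
      define T where "T = (\<Sum>k\<le>n. S_value a p q u v k)"
      define M where "M = real (Suc n) * K"
      have M: "0 < M" using K by (simp add: M_def)
      have inv: "ennreal (1 / M) * ennreal M = 1"
        using M by (simp flip: ennreal_mult)
      have "ennreal (1 / M) * T \<le> c" if c: "sum_bounded_by n a p q u v c" for c
      proof -
        have "T \<le> (\<Sum>k\<le>n. ennreal K * c)"
          unfolding T_def by (rule sum_mono) (use S_le[OF c] in simp)
        also have "\<dots> = ennreal M * c"
          using K by (simp add: M_def ennreal_mult ennreal_of_nat_eq_real_of_nat mult.assoc del: of_nat_Suc)
        finally have "ennreal (1 / M) * T \<le> ennreal (1 / M) * (ennreal M * c)"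
          by (rule mult_left_mono) simp
        then show ?thesis by (simp only: mult.assoc[symmetric] inv mult_1)
      qed
      then have "ennreal (1 / M) * T \<le> best_constant n a p q u v"
        unfolding best_constant_def by (intro Inf_greatest) auto
      then have "ennreal M * (ennreal (1 / M) * T) \<le> ennreal M * best_constant n a p q u v"
        by (rule mult_left_mono) simp
      moreover have "ennreal M * (ennreal (1 / M) * T) = T"
        using inv by (simp only: mult.assoc[symmetric] mult.commute[of "ennreal M"] mult_1)
      ultimately show ?thesis by (simp only: T_def M_def K_def)
    qed
    show ?thesis using equiv lower upper by blast
  qed
  show ?thesis
    by (rule exI[of _ "1 / 4"], intro conjI allI impI, simp,
        rule exI[of _ "real (Suc n) * (real (Suc n) * (3 ^ n * (4 * (2 * (1 + max 0 D)) ^ n)))" for n D],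
        intro allI impI, rule main)
qed

end
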